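(* Let $R\subseteq T$ be rings forming a regular conductor square with conductor $C$, and set $A=R/C$, $B=T/C$. Assume that $T$ is flat as an $R$-module, that $C$ is a principal ideal of $T$, and that every non-zero 2-generated ideal $I$ of $R$ satisfies the following condition: there are elements $r,s\in R$ and an ideal $U\subseteq R$ such that $UT=T=rT$ and $rI=sU$, and such that the multiplication maps $I\xrightarrow{r}rI$ and $U\xrightarrow{s}sU$ are isomorphisms. Assume further that $A$ is a (possibly infinite) product $\prod_{\lambda\in\Lambda}A_\lambda$ of integral domains. Then $R$ is a finite conductor ring if and only if $A$ is a finite conductor ring; each of these conditions implies that $T$ is a finite conductor ring, and so is each ring $A_\lambda$.
   Context: All rings are commutative with identity. A conductor square consists of a ring $T$, a subring $R\subseteq T$ such that $R$ and $T$ have a common non-zero ideal, the largest common ideal $C$ of $R$ and $T$ (called the conductor of $T$ into $R$), and the rings $A=R/C$ and $B=T/C$, together with the inclusions $R\hookrightarrow T$, $A\hookrightarrow B$ and the projections $\eta_2\colon R\twoheadrightarrow A$, $\eta_1\colon T\twoheadrightarrow B$; equivalently, $R$ is the pullback $\{(a,t)\in A\times T\mid a=\eta_1(t)\text{ in }B\}$ and $C=\operatorname{Ker}(\eta_1)=\operatorname{Ker}(\eta_2)$ is the largest common ideal. The square is regular if $C$ contains a non-zero-divisor of $T$. An ideal is 2-generated if it can be generated by two elements. A ring is a finite conductor ring if every 2-generated ideal of it is finitely presented. *)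

theory Defs
  imports "HOL-Algebra.Algebra"
begin

section \<open>Modules over a commutative ring\<close>

definition module_hom ::
  "('r, 'x) ring_scheme \<Rightarrow> ('r, 'm, 'y) module_scheme \<Rightarrow> ('r, 'n, 'z) module_scheme \<Rightarrow> ('m \<Rightarrow> 'n) set"
  where "module_hom R M N =
    {h \<in> carrier M \<rightarrow> carrier N.
      (\<forall>x\<in>carrier M. \<forall>y\<in>carrier M. h (x \<oplus>\<^bsub>M\<^esub> y) = h x \<oplus>\<^bsub>N\<^esub> h y) \<and>
      (\<forall>a\<in>carrier R. \<forall>x\<in>carrier M. h (a \<odot>\<^bsub>M\<^esub> x) = a \<odot>\<^bsub>N\<^esub> h x)}"

definition module_iso ::
  "('r, 'x) ring_scheme \<Rightarrow> ('r, 'm, 'y) module_scheme \<Rightarrow> ('r, 'n, 'z) module_scheme \<Rightarrow> ('m \<Rightarrow> 'n) set"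
  where "module_iso R M N = {h \<in> module_hom R M N. bij_betw h (carrier M) (carrier N)}"

text \<open>The ring \<open>S\<close> with its multiplication as scalar multiplication. Since carriers are
  explicit, this is at the same time the module structure of \<open>S\<close> over each of its subrings.
  The \<open>mult\<close> and \<open>one\<close> fields play no role for modules.\<close>

definition regular_module :: "('r, 'x) ring_scheme \<Rightarrow> ('r, 'r) module"
  where "regular_module S =
    \<lparr>carrier = carrier S, monoid.mult = monoid.mult S, one = one S, ring.zero = ring.zero S, add = add S,
     smult = monoid.mult S\<rparr>"

definition ideal_module :: "('r, 'x) ring_scheme \<Rightarrow> 'r set \<Rightarrow> ('r, 'r) module"
  where "ideal_module R I = (regular_module R)\<lparr>carrier := I\<rparr>"

definition submodule_span :: "('r, 'x) ring_scheme \<Rightarrow> ('r, 'm, 'y) module_scheme \<Rightarrow> 'm set \<Rightarrow> 'm set"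
  where "submodule_span R M G = \<Inter>{H. submodule H R M \<and> G \<subseteq> H}"

definition fg_submodule :: "'m set \<Rightarrow> ('r, 'x) ring_scheme \<Rightarrow> ('r, 'm, 'y) module_scheme \<Rightarrow> bool"
  where "fg_submodule H R M \<longleftrightarrow>
    submodule H R M \<and> (\<exists>G. finite G \<and> G \<subseteq> H \<and> H = submodule_span R M G)"

definition product_ring :: "'i set \<Rightarrow> ('i \<Rightarrow> ('d, 'x) ring_scheme) \<Rightarrow> ('i \<Rightarrow> 'd) ring"
  where "product_ring I D =
    \<lparr>carrier = (\<Pi>\<^sub>E i\<in>I. carrier (D i)),
     monoid.mult = (\<lambda>x y. \<lambda>i\<in>I. x i \<otimes>\<^bsub>D i\<^esub> y i),
     one = (\<lambda>i\<in>I. \<one>\<^bsub>D i\<^esub>),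
     ring.zero = (\<lambda>i\<in>I. \<zero>\<^bsub>D i\<^esub>),
     add = (\<lambda>x y. \<lambda>i\<in>I. x i \<oplus>\<^bsub>D i\<^esub> y i)\<rparr>"

text \<open>The free module $R^n$; its \<open>mult\<close> and \<open>one\<close> fields again play no role.\<close>

definition free_module :: "('r, 'x) ring_scheme \<Rightarrow> nat \<Rightarrow> ('r, nat \<Rightarrow> 'r) module"
  where "free_module R n =
    ring.extend (product_ring {..<n} (\<lambda>_. R))
      (module.fields (\<lambda>a x. \<lambda>i\<in>{..<n}. a \<otimes>\<^bsub>R\<^esub> x i))"

definition finitely_presented :: "('r, 'x) ring_scheme \<Rightarrow> ('r, 'm, 'y) module_scheme \<Rightarrow> bool"
  where "finitely_presented R M \<longleftrightarrow>
    module R M \<and>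
    (\<exists>n. \<exists>h\<in>module_hom R (free_module R n) M.
       h ` carrier (free_module R n) = carrier M \<and>
       fg_submodule (a_kernel (free_module R n) M h) R (free_module R n))"


section \<open>Tensor products and flatness\<close>

text \<open>$M \otimes_R N$ is the free abelian group on $M \times N$ modulo the bilinearity
  relations. Subtraction of formal sums is the one of the type of finitely supported functions.\<close>

definition tensor_relations ::
  "('r, 'x) ring_scheme \<Rightarrow> ('r, 'm, 'y) module_scheme \<Rightarrow> ('r, 'n, 'z) module_scheme
    \<Rightarrow> ('m \<times> 'n \<Rightarrow>\<^sub>0 int) set"
  where "tensor_relations R M N =
    generate (free_Abelian_group (carrier M \<times> carrier N))
      ({frag_of (x \<oplus>\<^bsub>M\<^esub> x', y) - frag_of (x, y) - frag_of (x', y) | x x' y.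
          x \<in> carrier M \<and> x' \<in> carrier M \<and> y \<in> carrier N} \<union>
       {frag_of (x, y \<oplus>\<^bsub>N\<^esub> y') - frag_of (x, y) - frag_of (x, y') | x y y'.
          x \<in> carrier M \<and> y \<in> carrier N \<and> y' \<in> carrier N} \<union>
       {frag_of (a \<odot>\<^bsub>M\<^esub> x, y) - frag_of (x, a \<odot>\<^bsub>N\<^esub> y) | a x y.
          a \<in> carrier R \<and> x \<in> carrier M \<and> y \<in> carrier N})"

definition tensor_product ::
  "('r, 'x) ring_scheme \<Rightarrow> ('r, 'm, 'y) module_scheme \<Rightarrow> ('r, 'n, 'z) module_scheme
    \<Rightarrow> ('m \<times> 'n \<Rightarrow>\<^sub>0 int) set monoid"
  where "tensor_product R M N =
    free_Abelian_group (carrier M \<times> carrier N) Mod tensor_relations R M N"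

text \<open>For $f : M' \to M$, the map $f \otimes \mathrm{id}_N : M' \otimes_R N \to M \otimes_R N$
  on cosets. When \<open>f\<close> is \<open>R\<close>-linear, all members of a coset \<open>A\<close> are sent to the same coset, so
  that the union below is this one coset.\<close>

definition tensor_map ::
  "('r, 'x) ring_scheme \<Rightarrow> ('m' \<Rightarrow> 'm) \<Rightarrow> ('r, 'm, 'y) module_scheme \<Rightarrow> ('r, 'n, 'z) module_scheme
    \<Rightarrow> ('m' \<times> 'n \<Rightarrow>\<^sub>0 int) set \<Rightarrow> ('m \<times> 'n \<Rightarrow>\<^sub>0 int) set"
  where "tensor_map R f M N A =
    (\<Union>u\<in>A. r_coset (free_Abelian_group (carrier M \<times> carrier N)) (tensor_relations R M N)
        (frag_extend (\<lambda>(x, y). frag_of (f x, y)) u))"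

text \<open>\<open>N\<close> is flat: tensoring with \<open>N\<close> preserves injectivity of linear maps between \<open>R\<close>-modules.
  A HOL formula cannot quantify over modules of all types, so the type \<open>'u\<close> of the elements of
  the test modules is a parameter. It has to be large enough; any type into which \<open>'r\<close> embeds
  will do, since inclusions of ideals of \<open>R\<close> suffice to test flatness.\<close>

definition flat_module :: "'u itself \<Rightarrow> ('r, 'x) ring_scheme \<Rightarrow> ('r, 'n, 'z) module_scheme \<Rightarrow> bool"
  where "flat_module (_ :: 'u itself) R N \<longleftrightarrow>
    module R N \<and>
    (\<forall>(M' :: ('r, 'u) module) (M :: ('r, 'u) module) f.
       module R M' \<and> module R M \<and> f \<in> module_hom R M' M \<and> inj_on f (carrier M') \<longrightarrow>
       inj_on (tensor_map R f M N) (carrier (tensor_product R M' N)))"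


section \<open>Finite conductor rings and conductor squares\<close>

definition two_generated_ideal :: "'r set \<Rightarrow> ('r, 'x) ring_scheme \<Rightarrow> bool"
  where "two_generated_ideal I R \<longleftrightarrow> (\<exists>a\<in>carrier R. \<exists>b\<in>carrier R. I = Idl\<^bsub>R\<^esub> {a, b})"

definition finite_conductor_ring :: "('r, 'x) ring_scheme \<Rightarrow> bool"
  where "finite_conductor_ring R \<longleftrightarrow>
    cring R \<and> (\<forall>I. two_generated_ideal I R \<longrightarrow> finitely_presented R (ideal_module R I))"

abbreviation subring_of :: "('r, 'x) ring_scheme \<Rightarrow> 'r set \<Rightarrow> ('r, 'x) ring_scheme"
  where "subring_of T R \<equiv> T\<lparr>carrier := R\<rparr>"

definition common_ideal :: "'r set \<Rightarrow> 'r set \<Rightarrow> ('r, 'x) ring_scheme \<Rightarrow> bool"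
  where "common_ideal J R T \<longleftrightarrow> ideal J (subring_of T R) \<and> ideal J T"

text \<open>The subring \<open>R\<close> of \<open>T\<close> is given by its carrier, \<open>C\<close> is the conductor. The other corners
  of the square are the quotients \<open>subring_of T R Quot C\<close> and \<open>T Quot C\<close>.\<close>

definition conductor_square :: "'r set \<Rightarrow> ('r, 'x) ring_scheme \<Rightarrow> 'r set \<Rightarrow> bool"
  where "conductor_square R T C \<longleftrightarrow>
    cring T \<and> subcring R T \<and>
    (\<exists>J. common_ideal J R T \<and> J \<noteq> {\<zero>\<^bsub>T\<^esub>}) \<and>
    common_ideal C R T \<and> (\<forall>J. common_ideal J R T \<longrightarrow> J \<subseteq> C)"

definition non_zero_divisor :: "'r \<Rightarrow> ('r, 'x) ring_scheme \<Rightarrow> bool"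
  where "non_zero_divisor c T \<longleftrightarrow>
    c \<in> carrier T \<and> (\<forall>t\<in>carrier T. c \<otimes>\<^bsub>T\<^esub> t = \<zero>\<^bsub>T\<^esub> \<longrightarrow> t = \<zero>\<^bsub>T\<^esub>)"

definition regular_conductor_square :: "'r set \<Rightarrow> ('r, 'x) ring_scheme \<Rightarrow> 'r set \<Rightarrow> bool"
  where "regular_conductor_square R T C \<longleftrightarrow>
    conductor_square R T C \<and> (\<exists>c\<in>C. non_zero_divisor c T)"

definition ring_multiple :: "('r, 'x) ring_scheme \<Rightarrow> 'r \<Rightarrow> 'r set \<Rightarrow> 'r set"
  where "ring_multiple T r I = (\<lambda>x. r \<otimes>\<^bsub>T\<^esub> x) ` I"

end

theory Submission
  imports Defs
begin

text \<open>By Schanuel's argument, a two-generated ideal \<open>(a, b)\<close> is finitely presented iff the module of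
  syzygies \<open>{(x, y). x a + y b = 0}\<close> is finitely generated. The condition on ideals replaces the
  syzygies over \<open>R\<close> of a pair \<open>(a, b) \<noteq> 0\<close> by those of a pair \<open>(u, v)\<close> that generates the unit ideal
  of \<open>T\<close>, where \<open>r a = s u\<close> and \<open>r b = s v\<close> with \<open>r\<close> a unit and \<open>s\<close> a non-zero-divisor of \<open>T\<close>; that \<open>s\<close>
  is one holds because the ideal \<open>(u, v)\<close> of \<open>R\<close> contains \<open>C\<close>.

  Let \<open>p u + q v = 1\<close> in \<open>T\<close>. Over \<open>T\<close> the syzygies of \<open>(u, v)\<close> are the multiples of \<open>(v, -u)\<close>; since
  a multiple of any pair in \<open>T\<close> by a non-zero-divisor in \<open>C\<close> is a pair in \<open>R\<close>, this makes \<open>T\<close> a finite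
  conductor ring. Every syzygy over \<open>A\<close> of the images of \<open>u\<close> and \<open>v\<close> lifts to \<open>R\<close>: if \<open>c = x u + y v\<close>
  lies in \<open>C\<close>, subtract \<open>(c p, c q)\<close> from \<open>(x, y)\<close>. The syzygies over \<open>R\<close> with entries in \<open>C\<close> are the
  \<open>t (v, -u)\<close> with \<open>t \<in> C\<close>, and flatness places them in a finitely generated module of syzygies. So
  the syzygies of \<open>(u, v)\<close> are finitely generated over \<open>R\<close> iff they are so over \<open>A\<close>.

  In \<open>A\<close> the image of \<open>s\<close> may be a zero divisor, but in a product of domains it has the same
  annihilator as an idempotent, which splits off a direct summand. The factors \<open>A\<^sub>\<lambda>\<close> inherit the
  property through the idempotents that cut them out.\<close>

section \<open>Syzygies of pairs and finite presentation\<close>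

text \<open>For \<open>G\<close> within the carrier this is the submodule of \<open>R\<close>^2
  generated by \<open>G\<close>. Adding one multiple of a generator at a time makes the length of a
  linear combination available for induction.\<close>

inductive_set pair_span :: "('r, 'x) ring_scheme \<Rightarrow> ('r \<times> 'r) set \<Rightarrow> ('r \<times> 'r) set"
  for R (structure) and G where
  zero: "(\<zero>, \<zero>) \<in> pair_span R G"
| step: "(x, y) \<in> pair_span R G \<Longrightarrow> (p, q) \<in> G \<Longrightarrow> c \<in> carrier R
    \<Longrightarrow> (x \<oplus> c \<otimes> p, y \<oplus> c \<otimes> q) \<in> pair_span R G"

definition syzygies :: "('r, 'x) ring_scheme \<Rightarrow> 'r \<Rightarrow> 'r \<Rightarrow> ('r \<times> 'r) set"
  where "syzygies R a b = {(x, y) \<in> carrier R \<times> carrier R. x \<otimes>\<^bsub>R\<^esub> a \<oplus>\<^bsub>R\<^esub> y \<otimes>\<^bsub>R\<^esub> b = \<zero>\<^bsub>R\<^esub>}"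

text \<open>One inclusion expresses generation, because the span of a set of syzygies consists of
  syzygies (\<open>pair_span_syzygies\<close>).\<close>

definition syzygies_fg :: "('r, 'x) ring_scheme \<Rightarrow> 'r \<Rightarrow> 'r \<Rightarrow> bool"
  where "syzygies_fg R a b \<longleftrightarrow>
    (\<exists>G. finite G \<and> G \<subseteq> syzygies R a b \<and> syzygies R a b \<subseteq> pair_span R G)"

lemma mem_syzygies:
  "(x, y) \<in> syzygies R a b \<longleftrightarrow>
    x \<in> carrier R \<and> y \<in> carrier R \<and> x \<otimes>\<^bsub>R\<^esub> a \<oplus>\<^bsub>R\<^esub> y \<otimes>\<^bsub>R\<^esub> b = \<zero>\<^bsub>R\<^esub>"
  by (auto simp: syzygies_def)

lemma syzygies_subset: "syzygies R a b \<subseteq> carrier R \<times> carrier R"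
  by (auto simp: syzygies_def)

lemma pair_span_mono: "(x, y) \<in> pair_span R G \<Longrightarrow> G \<subseteq> G' \<Longrightarrow> (x, y) \<in> pair_span R G'"
  by (induction rule: pair_span.induct) (auto intro: pair_span.intros)

context cring
begin

lemma pair_span_closed:
  assumes "(x, y) \<in> pair_span R G" "G \<subseteq> carrier R \<times> carrier R"
  shows "x \<in> carrier R \<and> y \<in> carrier R"
  using assms by (induction rule: pair_span.induct) auto

lemma pair_span_add:
  assumes G: "G \<subseteq> carrier R \<times> carrier R"
    and "(x, y) \<in> pair_span R G" "(x', y') \<in> pair_span R G"
  shows "(x \<oplus> x', y \<oplus> y') \<in> pair_span R G"
  \<comment> \<open>The induction runs over the second summand; membership of the first is carried
    along as a premise.\<close>
  using assms(3,2)
proof (induction rule: pair_span.induct)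
  case zero
  then show ?case using pair_span_closed[OF _ G] by fastforce
next
  case (step x' y' p q c)
  then have "x \<in> carrier R" "y \<in> carrier R" "x' \<in> carrier R" "y' \<in> carrier R"
    "p \<in> carrier R" "q \<in> carrier R"
    using pair_span_closed[OF _ G] G by fastforce+
  then have "x \<oplus> (x' \<oplus> c \<otimes> p) = (x \<oplus> x') \<oplus> c \<otimes> p" "y \<oplus> (y' \<oplus> c \<otimes> q) = (y \<oplus> y') \<oplus> c \<otimes> q"
    using step.hyps by (simp_all add: a_assoc)
  then show ?case
    using pair_span.step[OF step.IH[OF step.prems] step.hyps(2,3)] by simp
qed

lemma pair_span_smult:
  assumes G: "G \<subseteq> carrier R \<times> carrier R" and d: "d \<in> carrier R"
    and "(x, y) \<in> pair_span R G"
  shows "(d \<otimes> x, d \<otimes> y) \<in> pair_span R G"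
  using assms(3)
proof (induction rule: pair_span.induct)
  case zero
  then show ?case using d by (simp add: pair_span.zero)
next
  case (step x y p q c)
  then have "x \<in> carrier R" "y \<in> carrier R" "p \<in> carrier R" "q \<in> carrier R"
    using pair_span_closed[OF _ G] G by fastforce+
  then have "d \<otimes> (x \<oplus> c \<otimes> p) = d \<otimes> x \<oplus> (d \<otimes> c) \<otimes> p"
    "d \<otimes> (y \<oplus> c \<otimes> q) = d \<otimes> y \<oplus> (d \<otimes> c) \<otimes> q"
    using step.hyps d by (simp_all add: r_distr m_assoc)
  then show ?case
    using pair_span.step[OF step.IH step.hyps(2), of "d \<otimes> c"] step.hyps d by simp
qed

lemma pair_span_smult_gen:
  assumes G: "G \<subseteq> carrier R \<times> carrier R" and d: "d \<in> carrier R" and g: "(p, q) \<in> G"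
  shows "(d \<otimes> p, d \<otimes> q) \<in> pair_span R G"
proof -
  have "p \<in> carrier R" "q \<in> carrier R"
    using g G by auto
  then show ?thesis
    using pair_span.step[OF pair_span.zero g d] d by simp
qed

lemma pair_span_syzygies:
  assumes a: "a \<in> carrier R" and b: "b \<in> carrier R"
    and G: "G \<subseteq> syzygies R a b" and z: "(x, y) \<in> pair_span R G"
  shows "(x, y) \<in> syzygies R a b"
  using z
proof (induction rule: pair_span.induct)
  case zero
  show ?case using a b by (simp add: mem_syzygies)
next
  case (step x y p q c)
  then have g: "(p, q) \<in> syzygies R a b" using G by blast
  have "(x \<oplus> c \<otimes> p) \<otimes> a \<oplus> (y \<oplus> c \<otimes> q) \<otimes> b
      = (x \<otimes> a \<oplus> y \<otimes> b) \<oplus> c \<otimes> (p \<otimes> a \<oplus> q \<otimes> b)"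
    using step g a b unfolding mem_syzygies by algebra
  then show ?case
    using step g a b by (simp add: mem_syzygies)
qed

section \<open>Two-generated ideals, and ideals and free modules as modules\<close>

lemma ideal_two_gen:
  assumes a: "a \<in> carrier R" and b: "b \<in> carrier R"
  shows "Idl {a, b} = {x \<otimes> a \<oplus> y \<otimes> b | x y. x \<in> carrier R \<and> y \<in> carrier R}" (is "_ = ?I")
proof
  have I: "ideal ?I R"
  proof (rule idealI[OF ring_axioms])
    show "subgroup ?I (add_monoid R)"
    proof (rule add.subgroupI)
      show "?I \<subseteq> carrier R" using a b by auto
      have "\<zero> \<otimes> a \<oplus> \<zero> \<otimes> b \<in> ?I" by blast
      then show "?I \<noteq> {}" by blast
    next
      fix z assume "z \<in> ?I"
      then obtain x y where "x \<in> carrier R" "y \<in> carrier R" "z = x \<otimes> a \<oplus> y \<otimes> b" by blast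
      moreover from this have "\<ominus> z = (\<ominus> x) \<otimes> a \<oplus> (\<ominus> y) \<otimes> b" using a b by algebra
      ultimately show "\<ominus> z \<in> ?I" by blast
    next
      fix z w assume "z \<in> ?I" "w \<in> ?I"
      then obtain x y x' y' where xy: "x \<in> carrier R" "y \<in> carrier R" "z = x \<otimes> a \<oplus> y \<otimes> b"
        "x' \<in> carrier R" "y' \<in> carrier R" "w = x' \<otimes> a \<oplus> y' \<otimes> b" by blast
      then have "z \<oplus> w = (x \<oplus> x') \<otimes> a \<oplus> (y \<oplus> y') \<otimes> b" using a b by algebra
      then show "z \<oplus> w \<in> ?I" using xy by blast
    qed
  next
    fix z w assume "z \<in> ?I" and w: "w \<in> carrier R"
    then obtain x y where xy: "x \<in> carrier R" "y \<in> carrier R" "z = x \<otimes> a \<oplus> y \<otimes> b" by blast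
    then have "w \<otimes> z = (w \<otimes> x) \<otimes> a \<oplus> (w \<otimes> y) \<otimes> b" using a b w by algebra
    then show 1: "w \<otimes> z \<in> ?I" using xy w by blast
    show "z \<otimes> w \<in> ?I" using 1 xy w a b by (simp add: m_comm)
  qed
  have "a = \<one> \<otimes> a \<oplus> \<zero> \<otimes> b" "b = \<zero> \<otimes> a \<oplus> \<one> \<otimes> b" using a b by auto
  then have "{a, b} \<subseteq> ?I" by blast
  then show "Idl {a, b} \<subseteq> ?I" by (rule genideal_minimal[OF I])
  interpret J: ideal "Idl {a, b}" R using a b by (simp add: genideal_ideal)
  have "a \<in> Idl {a, b}" "b \<in> Idl {a, b}" using genideal_self[of "{a, b}"] a b by auto
  then show "?I \<subseteq> Idl {a, b}" by (auto intro!: J.a_closed J.I_l_closed)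
qed

lemma module_ideal:
  assumes "ideal I R"
  shows "module R (ideal_module R I)"
proof -
  interpret ideal I R by fact
  have "abelian_group (ideal_module R I)"
    unfolding ideal_module_def regular_module_def
    by (rule abelian_groupI)
      (use Icarr in \<open>auto simp: a_ac intro!: bexI[where x = "\<ominus> x" for x] r_neg\<close>)
  then show ?thesis
    by (intro moduleI is_cring)
      (use Icarr in \<open>auto simp: ideal_module_def regular_module_def l_distr r_distr m_assoc I_l_closed\<close>)
qed

lemma free_module_simps:
  "carrier (free_module R n) = (\<Pi>\<^sub>E i\<in>{..<n}. carrier R)"
  "\<zero>\<^bsub>free_module R n\<^esub> = (\<lambda>i\<in>{..<n}. \<zero>)"
  "x \<oplus>\<^bsub>free_module R n\<^esub> y = (\<lambda>i\<in>{..<n}. x i \<oplus> y i)"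
  "c \<odot>\<^bsub>free_module R n\<^esub> x = (\<lambda>i\<in>{..<n}. c \<otimes> x i)"
  by (simp_all add: free_module_def product_ring_def ring.defs module.defs)

lemma module_free: "module R (free_module R n)"
proof -
  have "abelian_group (free_module R n)"
  proof (rule abelian_groupI)
    fix x assume "x \<in> carrier (free_module R n)"
    then show "\<exists>y\<in>carrier (free_module R n). y \<oplus>\<^bsub>free_module R n\<^esub> x = \<zero>\<^bsub>free_module R n\<^esub>"
      by (intro bexI[of _ "\<lambda>i\<in>{..<n}. \<ominus> x i"])
        (auto simp: free_module_simps PiE_iff l_neg intro!: restrict_ext)
  qed (auto simp: free_module_simps PiE_iff a_ac intro!: ext simp: extensional_def)
  then show ?thesis
    by (intro moduleI is_cring)
      (auto simp: free_module_simps PiE_iff l_distr r_distr m_assoc extensional_def intro!: ext)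
qed

end

lemma ideal_module_simps:
  "carrier (ideal_module R I) = I"
  "\<zero>\<^bsub>ideal_module R I\<^esub> = \<zero>\<^bsub>R\<^esub>"
  "x \<oplus>\<^bsub>ideal_module R I\<^esub> y = x \<oplus>\<^bsub>R\<^esub> y"
  "c \<odot>\<^bsub>ideal_module R I\<^esub> x = c \<otimes>\<^bsub>R\<^esub> x"
  by (simp_all add: ideal_module_def regular_module_def)

lemma mem_a_kernel: "x \<in> a_kernel M N h \<longleftrightarrow> x \<in> carrier M \<and> h x = \<zero>\<^bsub>N\<^esub>"
  by (simp add: a_kernel_def' kernel_def)

lemma module_homD:
  assumes "h \<in> module_hom R M N"
  shows "x \<in> carrier M \<Longrightarrow> h x \<in> carrier N"
    and "x \<in> carrier M \<Longrightarrow> y \<in> carrier M \<Longrightarrow> h (x \<oplus>\<^bsub>M\<^esub> y) = h x \<oplus>\<^bsub>N\<^esub> h y"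
    and "c \<in> carrier R \<Longrightarrow> x \<in> carrier M \<Longrightarrow> h (c \<odot>\<^bsub>M\<^esub> x) = c \<odot>\<^bsub>N\<^esub> h x"
  using assms by (auto simp: module_hom_def)

lemma (in module) submodule_kernel:
  assumes N: "module R N" and h: "h \<in> module_hom R M N"
  shows "submodule (a_kernel M N h) R M"
proof -
  interpret N: module R N by fact
  note hom = module_homD[OF h]
  have z: "h \<zero>\<^bsub>M\<^esub> = \<zero>\<^bsub>N\<^esub>"
    using hom(3)[of "\<zero>\<^bsub>R\<^esub>" "\<zero>\<^bsub>M\<^esub>"] hom(1)[of "\<zero>\<^bsub>M\<^esub>"] by simp
  show ?thesis
  proof (rule submoduleI)
    fix x assume x: "x \<in> a_kernel M N h"
    have "\<ominus>\<^bsub>M\<^esub> x = (\<ominus> \<one>) \<odot>\<^bsub>M\<^esub> x"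
      using x by (simp add: mem_a_kernel smult_l_minus)
    then show "\<ominus>\<^bsub>M\<^esub> x \<in> a_kernel M N h"
      using x hom(3)[of "\<ominus> \<one>" x] by (simp add: mem_a_kernel)
  qed (use hom z in \<open>auto simp: mem_a_kernel\<close>)
qed

section \<open>Finite presentation of an ideal (a, b) and generation of its syzygies\<close>

context cring
begin

text \<open>Additivity passes from two summands to \<open>n\<close> by induction on
  \<open>k\<close>, applied to the truncation \<open>t k\<close> of \<open>x\<close> to its first
  \<open>k\<close> coordinates. By extensionality \<open>t n\<close> is \<open>x\<close>.\<close>

lemma free_module_hom_eq:
  assumes h: "h \<in> module_hom R (free_module R n) (ideal_module R I)" and I: "ideal I R"
    and x: "x \<in> carrier (free_module R n)"
  shows "h x = (\<Oplus>i\<in>{..<n}. x i \<otimes> h (\<lambda>j\<in>{..<n}. if j = i then \<one> else \<zero>))"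
proof -
  interpret I: ideal I R by fact
  define E where "E i = (\<lambda>j\<in>{..<n}. if j = i then \<one> else \<zero>)" for i
  note hom = module_homD[OF h]
  define t where "t k = (\<lambda>j\<in>{..<n}. if j < k then x j else \<zero>)" for k
  have xi: "x i \<in> carrier R" if "i < n" for i
    using x that by (auto simp: free_module_simps)
  have E: "E i \<in> carrier (free_module R n)" for i
    by (auto simp: E_def free_module_simps)
  have t: "t k \<in> carrier (free_module R n)" for k
    using xi by (auto simp: t_def free_module_simps)
  have hE: "h (E i) \<in> carrier R" for i
    using I.Icarr[OF hom(1)[OF E, unfolded ideal_module_simps]] .
  have "h (t k) = (\<Oplus>i\<in>{..<k}. x i \<otimes> h (E i))" if "k \<le> n" for k
    using that
  proof (induction k)
    case 0
    \<comment> \<open>The zero vector is its own multiple by \<zero>, so compatibility with scalars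
      gives \<open>h (t 0) = \<zero>\<close>.\<close>
    have "t 0 = \<zero> \<odot>\<^bsub>free_module R n\<^esub> t 0"
      by (auto simp: t_def free_module_simps)
    then have "h (t 0) = \<zero> \<otimes> h (t 0)"
      using hom(3)[OF zero_closed t[of 0]] by (simp only: ideal_module_simps)
    moreover have "h (t 0) \<in> carrier R"
      using I.Icarr[OF hom(1)[OF t, unfolded ideal_module_simps]] .
    ultimately show ?case by simp
  next
    case (Suc k)
    have "t (Suc k) = t k \<oplus>\<^bsub>free_module R n\<^esub> x k \<odot>\<^bsub>free_module R n\<^esub> E k"
      using xi Suc.prems by (auto simp: t_def E_def free_module_simps less_Suc_eq intro!: ext)
    then have "h (t (Suc k)) = h (t k) \<oplus> x k \<otimes> h (E k)"
      using hom(2)[OF t module.smult_closed[OF module_free _ E]] hom(3)[OF _ E] xi[of k] Suc.prems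
      by (simp add: ideal_module_simps)
    then show ?case
      using Suc xi hE by (simp add: lessThan_Suc a_comm Pi_iff)
  qed
  from this[of n] have "h (t n) = (\<Oplus>i\<in>{..<n}. x i \<otimes> h (E i))" by simp
  moreover have "t n = x"
    using x by (auto simp: t_def free_module_simps PiE_iff extensional_def)
  ultimately show ?thesis by (simp add: E_def)
qed

text \<open>Schanuel's lemma with explicit lifts. The map \<open>?\<phi>\<close> lifts the given
  presentation \<open>h\<close> to the standard one from \<open>R\<close>^2, and \<open>v\<close>,
  \<open>w\<close> lift the two standard generators back. A syzygy (x, y) is then the image under
  \<open>?\<phi>\<close> of the kernel element x v + y w, plus x and y times the amounts by which
  the round trip misses the basis vectors of \<open>R\<close>^2.\<close>

lemma finitely_presented_imp_syzygies_fg: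
  assumes a: "a \<in> carrier R" and b: "b \<in> carrier R"
    and fp: "finitely_presented R (ideal_module R (Idl {a, b}))"
  shows "syzygies_fg R a b"
proof -
  let ?I = "Idl {a, b}"
  have I: "ideal ?I R" using a b by (simp add: genideal_ideal)
  interpret I: ideal ?I R by fact
  obtain n h where h: "h \<in> module_hom R (free_module R n) (ideal_module R ?I)"
    and surj: "h ` carrier (free_module R n) = ?I"
    and fg: "fg_submodule (a_kernel (free_module R n) (ideal_module R ?I) h) R (free_module R n)"
    using fp by (auto simp: finitely_presented_def ideal_module_simps)
  let ?F = "free_module R n" and ?E = "\<lambda>i. \<lambda>j\<in>{..<n}. if j = i then \<one> else \<zero>"
  let ?K = "a_kernel ?F (ideal_module R ?I) h"
  interpret F: module R ?F by (rule module_free)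
  \<comment> \<open>For \<open>i\<close> outside \<open>{..<n}\<close> the vector
    \<open>?E i\<close> is zero and still in the carrier, so coefficients can be chosen for all
    \<open>i\<close> and no bound has to be carried along.\<close>
  have "\<forall>i. \<exists>x y. x \<in> carrier R \<and> y \<in> carrier R \<and> h (?E i) = x \<otimes> a \<oplus> y \<otimes> b"
  proof
    fix i
    have "h (?E i) \<in> ?I"
      by (rule module_homD(1)[OF h, unfolded ideal_module_simps]) (auto simp: free_module_simps)
    then show "\<exists>x y. x \<in> carrier R \<and> y \<in> carrier R \<and> h (?E i) = x \<otimes> a \<oplus> y \<otimes> b"
      unfolding ideal_two_gen[OF a b] by blast
  qed
  then obtain \<alpha> \<beta> where ab: "\<And>i. \<alpha> i \<in> carrier R" "\<And>i. \<beta> i \<in> carrier R"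
    and hE: "\<And>i. h (?E i) = \<alpha> i \<otimes> a \<oplus> \<beta> i \<otimes> b" by metis
  define \<phi> where "\<phi> \<gamma> x = (\<Oplus>i\<in>{..<n}. x i \<otimes> \<gamma> i)" for \<gamma> :: "nat \<Rightarrow> 'a" and x
  have xi: "x i \<in> carrier R" if "x \<in> carrier ?F" "i < n" for x i
    using that by (auto simp: free_module_simps)
  have \<phi>_closed: "\<phi> \<gamma> x \<in> carrier R"
    if "\<And>i. \<gamma> i \<in> carrier R" "x \<in> carrier ?F" for \<gamma> x
    using that xi by (auto simp: \<phi>_def intro!: finsum_closed)
  have \<phi>_add: "\<phi> \<gamma> (x \<oplus>\<^bsub>?F\<^esub> y) = \<phi> \<gamma> x \<oplus> \<phi> \<gamma> y"
    if "\<And>i. \<gamma> i \<in> carrier R" "x \<in> carrier ?F" "y \<in> carrier ?F" for \<gamma> x y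
  proof -
    have "\<phi> \<gamma> (x \<oplus>\<^bsub>?F\<^esub> y) = (\<Oplus>i\<in>{..<n}. x i \<otimes> \<gamma> i \<oplus> y i \<otimes> \<gamma> i)"
      unfolding \<phi>_def using that xi
      by (intro finsum_cong') (auto simp: free_module_simps(3) l_distr)
    also have "\<dots> = \<phi> \<gamma> x \<oplus> \<phi> \<gamma> y"
      unfolding \<phi>_def using that xi by (intro finsum_addf) auto
    finally show ?thesis .
  qed
  have \<phi>_smult: "\<phi> \<gamma> (c \<odot>\<^bsub>?F\<^esub> x) = c \<otimes> \<phi> \<gamma> x"
    if "\<And>i. \<gamma> i \<in> carrier R" "x \<in> carrier ?F" "c \<in> carrier R" for \<gamma> x c
  proof -
    have "\<phi> \<gamma> (c \<odot>\<^bsub>?F\<^esub> x) = (\<Oplus>i\<in>{..<n}. c \<otimes> (x i \<otimes> \<gamma> i))"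
      unfolding \<phi>_def using that xi
      by (intro finsum_cong') (auto simp: free_module_simps(4) m_assoc)
    also have "\<dots> = c \<otimes> \<phi> \<gamma> x"
      unfolding \<phi>_def using that xi by (intro finsum_rdistr[symmetric]) auto
    finally show ?thesis .
  qed
  have h\<phi>: "h x = \<phi> \<alpha> x \<otimes> a \<oplus> \<phi> \<beta> x \<otimes> b" if x: "x \<in> carrier ?F" for x
  proof -
    have "h x = (\<Oplus>i\<in>{..<n}. (x i \<otimes> \<alpha> i) \<otimes> a \<oplus> (x i \<otimes> \<beta> i) \<otimes> b)"
      unfolding free_module_hom_eq[OF h I x] using x xi ab a b
      by (intro finsum_cong') (auto simp: hE r_distr m_assoc)
    also have "\<dots> = (\<Oplus>i\<in>{..<n}. (x i \<otimes> \<alpha> i) \<otimes> a) \<oplus> (\<Oplus>i\<in>{..<n}. (x i \<otimes> \<beta> i) \<otimes> b)"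
      using x xi ab a b by (intro finsum_addf) auto
    also have "\<dots> = \<phi> \<alpha> x \<otimes> a \<oplus> \<phi> \<beta> x \<otimes> b"
      unfolding \<phi>_def using x xi ab a b by (subst (1 2) finsum_ldistr) auto
    finally show ?thesis .
  qed
  obtain G where G: "finite G" "G \<subseteq> ?K" "?K = submodule_span R ?F G"
    using fg by (auto simp: fg_submodule_def)
  have "a \<in> h ` carrier ?F" "b \<in> h ` carrier ?F"
    unfolding surj using genideal_self[of "{a, b}"] a b by auto
  then obtain v w where v: "v \<in> carrier ?F" "h v = a" and w: "w \<in> carrier ?F" "h w = b"
    by blast
  let ?\<phi> = "\<lambda>x. (\<phi> \<alpha> x, \<phi> \<beta> x)"
  \<comment> \<open>The extra pairs are (1, 0) - \<open>?\<phi> v\<close> and (0, 1) -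
    \<open>?\<phi> w\<close>. They are syzygies because \<open>h v = a\<close> and
    \<open>h w = b\<close>.\<close>
  define G' where "G' = ?\<phi> ` G \<union>
    {(\<one> \<ominus> \<phi> \<alpha> v, \<ominus> \<phi> \<beta> v), (\<ominus> \<phi> \<alpha> w, \<one> \<ominus> \<phi> \<beta> w)}"
  have closed: "\<phi> \<alpha> x \<in> carrier R" "\<phi> \<beta> x \<in> carrier R" if "x \<in> carrier ?F" for x
    using that ab by (auto intro: \<phi>_closed)
  have G'1: "?\<phi> x \<in> syzygies R a b" if "x \<in> ?K" for x
    using that h\<phi>[of x] closed[of x] by (simp add: mem_syzygies mem_a_kernel ideal_module_simps)
  have aux: "(\<one> \<ominus> p) \<otimes> a \<oplus> (\<ominus> q) \<otimes> b = a \<ominus> (p \<otimes> a \<oplus> q \<otimes> b)"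
    "(\<ominus> p) \<otimes> a \<oplus> (\<one> \<ominus> q) \<otimes> b = b \<ominus> (p \<otimes> a \<oplus> q \<otimes> b)"
    "x \<otimes> p \<oplus> y \<otimes> q \<oplus> (x \<otimes> (\<one> \<ominus> p) \<oplus> y \<otimes> (\<ominus> q)) = x"
    "x \<otimes> p \<oplus> y \<otimes> q \<oplus> (x \<otimes> (\<ominus> p) \<oplus> y \<otimes> (\<one> \<ominus> q)) = y"
    if "p \<in> carrier R" "q \<in> carrier R" "x \<in> carrier R" "y \<in> carrier R" for p q x y
    using that a b by algebra+
  have "(\<one> \<ominus> \<phi> \<alpha> v) \<otimes> a \<oplus> (\<ominus> \<phi> \<beta> v) \<otimes> b = a \<ominus> (\<phi> \<alpha> v \<otimes> a \<oplus> \<phi> \<beta> v \<otimes> b)"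
    using closed v a by (intro aux)
  then have G'2: "(\<one> \<ominus> \<phi> \<alpha> v, \<ominus> \<phi> \<beta> v) \<in> syzygies R a b"
    using h\<phi>[OF v(1)] closed[OF v(1)] v a by (simp add: mem_syzygies minus_eq r_neg)
  have "(\<ominus> \<phi> \<alpha> w) \<otimes> a \<oplus> (\<one> \<ominus> \<phi> \<beta> w) \<otimes> b = b \<ominus> (\<phi> \<alpha> w \<otimes> a \<oplus> \<phi> \<beta> w \<otimes> b)"
    using closed w a by (intro aux)
  then have G'3: "(\<ominus> \<phi> \<alpha> w, \<one> \<ominus> \<phi> \<beta> w) \<in> syzygies R a b"
    using h\<phi>[OF w(1)] closed[OF w(1)] w b by (simp add: mem_syzygies minus_eq r_neg)
  have G': "G' \<subseteq> syzygies R a b"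
    using G(2) G'1 G'2 G'3 by (auto simp: G'_def)
  have carr: "G' \<subseteq> carrier R \<times> carrier R"
    using G' syzygies_subset by (rule subset_trans)
  have \<phi>K: "?\<phi> k \<in> pair_span R G'" if k: "k \<in> ?K" for k
  proof -
    \<comment> \<open>The kernel is an intersection of submodules containing \<open>G\<close>. It is
      therefore contained in the preimage of \<open>pair_span R G'\<close> under
      \<open>?\<phi>\<close> once this preimage is seen to be such a submodule.\<close>
    let ?H = "{k \<in> carrier ?F. ?\<phi> k \<in> pair_span R G'}"
    have "submodule ?H R ?F"
    proof (rule F.submoduleI)
      have "\<phi> \<gamma> \<zero>\<^bsub>?F\<^esub> = \<zero>" if "\<And>i. \<gamma> i \<in> carrier R" for \<gamma>
        using \<phi>_smult[OF that F.zero_closed zero_closed] \<phi>_closed[OF that F.zero_closed] by simp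
      then show "\<zero>\<^bsub>?F\<^esub> \<in> ?H" using ab by (simp add: pair_span.zero)
    next
      fix x assume x: "x \<in> ?H"
      have "\<ominus>\<^bsub>?F\<^esub> x = (\<ominus> \<one>) \<odot>\<^bsub>?F\<^esub> x"
        using x by (simp add: F.smult_l_minus)
      then show "\<ominus>\<^bsub>?F\<^esub> x \<in> ?H"
        using x by (simp add: \<phi>_smult ab pair_span_smult[OF carr])
    qed (auto simp: \<phi>_smult \<phi>_add ab pair_span_smult[OF carr] pair_span_add[OF carr])
    moreover have "G \<subseteq> ?H"
    proof
      fix g assume g: "g \<in> G"
      then have "g \<in> carrier ?F" and g': "?\<phi> g \<in> G'"
        using G(2) by (auto simp: mem_a_kernel G'_def)
      then show "g \<in> ?H"
        using pair_span_smult_gen[OF carr one_closed g'] closed by simp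
    qed
    ultimately show ?thesis
      using k G(3) by (auto simp: submodule_span_def)
  qed
  have "(x, y) \<in> pair_span R G'" if xy: "(x, y) \<in> syzygies R a b" for x y
  proof -
    have x: "x \<in> carrier R" and y: "y \<in> carrier R" and 0: "x \<otimes> a \<oplus> y \<otimes> b = \<zero>"
      using xy by (auto simp: mem_syzygies)
    let ?k = "x \<odot>\<^bsub>?F\<^esub> v \<oplus>\<^bsub>?F\<^esub> y \<odot>\<^bsub>?F\<^esub> w"
    have "h ?k = x \<otimes> a \<oplus> y \<otimes> b"
      using module_homD[OF h] x y v w by (simp add: ideal_module_simps)
    then have "?k \<in> ?K"
      using 0 x y v w by (simp add: mem_a_kernel ideal_module_simps)
    from \<phi>K[OF this]
    have 1: "(x \<otimes> \<phi> \<alpha> v \<oplus> y \<otimes> \<phi> \<alpha> w, x \<otimes> \<phi> \<beta> v \<oplus> y \<otimes> \<phi> \<beta> w) \<in> pair_span R G'"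
      using x y v w ab by (simp add: \<phi>_smult \<phi>_add)
    have 2: "(x \<otimes> (\<one> \<ominus> \<phi> \<alpha> v), x \<otimes> (\<ominus> \<phi> \<beta> v)) \<in> pair_span R G'"
      by (rule pair_span_smult_gen[OF carr x]) (simp add: G'_def)
    have 3: "(y \<otimes> (\<ominus> \<phi> \<alpha> w), y \<otimes> (\<one> \<ominus> \<phi> \<beta> w)) \<in> pair_span R G'"
      by (rule pair_span_smult_gen[OF carr y]) (simp add: G'_def)
    have eq: "x \<otimes> \<phi> \<alpha> v \<oplus> y \<otimes> \<phi> \<alpha> w \<oplus> (x \<otimes> (\<one> \<ominus> \<phi> \<alpha> v) \<oplus> y \<otimes> (\<ominus> \<phi> \<alpha> w)) = x"
      "x \<otimes> \<phi> \<beta> v \<oplus> y \<otimes> \<phi> \<beta> w \<oplus> (x \<otimes> (\<ominus> \<phi> \<beta> v) \<oplus> y \<otimes> (\<one> \<ominus> \<phi> \<beta> w)) = y"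
      using x y closed[OF v(1)] closed[OF w(1)] by (simp_all add: aux)
    show ?thesis
      using pair_span_add[OF carr 1 pair_span_add[OF carr 2 3]] unfolding eq .
  qed
  then have "syzygies R a b \<subseteq> pair_span R G'" by auto
  moreover have "finite G'" using G(1) by (simp add: G'_def)
  ultimately show ?thesis using G' by (auto simp: syzygies_fg_def)
qed

text \<open>The presentation is the obvious map from \<open>R\<close>^2 onto (a, b), whose kernel is
  the syzygy module. \<open>enc\<close> translates pairs into extensional functions on
  \<open>{..<2}\<close>, and every submodule containing the encoded generators contains the encoded
  span by induction.\<close>

lemma syzygies_fg_imp_finitely_presented:
  assumes a: "a \<in> carrier R" and b: "b \<in> carrier R" and fg: "syzygies_fg R a b"
  shows "finitely_presented R (ideal_module R (Idl {a, b}))"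
proof -
  let ?I = "Idl {a, b}" and ?F = "free_module R 2"
  have I: "ideal ?I R" using a b by (simp add: genideal_ideal)
  have mod: "module R (ideal_module R ?I)" by (rule module_ideal[OF I])
  interpret F: module R ?F by (rule module_free)
  define h where "h = (\<lambda>x. x 0 \<otimes> a \<oplus> x (Suc 0) \<otimes> b)"
  define enc where "enc = (\<lambda>(x, y). \<lambda>i\<in>{..<2::nat}. if i = 0 then x else (y::'a))"
  have enc: "enc (x, y) \<in> carrier ?F" "h (enc (x, y)) = x \<otimes> a \<oplus> y \<otimes> b"
    if "x \<in> carrier R" "y \<in> carrier R" for x y
    using that by (auto simp: enc_def h_def free_module_simps PiE_iff)
  have x01: "x 0 \<in> carrier R" "x (Suc 0) \<in> carrier R" if "x \<in> carrier ?F" for x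
    using that unfolding free_module_simps by (simp_all add: PiE_iff)
  have enc_dec: "enc (x 0, x (Suc 0)) = x" if x: "x \<in> carrier ?F" for x
  proof
    fix i
    consider "i = 0" | "i = Suc 0" | "\<not> i < 2" by linarith
    then show "enc (x 0, x (Suc 0)) i = x i"
      using x by cases (auto simp: enc_def free_module_simps PiE_iff extensional_def)
  qed
  have hom: "h \<in> module_hom R ?F (ideal_module R ?I)"
    unfolding module_hom_def
  proof (intro CollectI conjI ballI Pi_I)
    fix x assume "x \<in> carrier ?F"
    then show "h x \<in> carrier (ideal_module R ?I)"
      unfolding ideal_module_simps ideal_two_gen[OF a b] h_def using x01 by blast
  next
    fix x y assume "x \<in> carrier ?F" "y \<in> carrier ?F"
    from x01[OF this(1)] x01[OF this(2)] a b
    show "h (x \<oplus>\<^bsub>?F\<^esub> y) = h x \<oplus>\<^bsub>ideal_module R ?I\<^esub> h y"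
      unfolding h_def ideal_module_simps free_module_simps by (simp add: l_distr a_ac)
  next
    fix c x assume "c \<in> carrier R" "x \<in> carrier ?F"
    with x01[OF this(2)] a b
    show "h (c \<odot>\<^bsub>?F\<^esub> x) = c \<odot>\<^bsub>ideal_module R ?I\<^esub> h x"
      unfolding h_def ideal_module_simps free_module_simps by (simp add: r_distr m_assoc)
  qed
  have surj: "h ` carrier ?F = carrier (ideal_module R ?I)"
  proof
    show "h ` carrier ?F \<subseteq> carrier (ideal_module R ?I)"
      using hom by (auto simp: module_hom_def)
    show "carrier (ideal_module R ?I) \<subseteq> h ` carrier ?F"
      unfolding ideal_module_simps ideal_two_gen[OF a b] using enc by (auto simp: image_iff) metis
  qed
  let ?K = "a_kernel ?F (ideal_module R ?I) h"
  have sub: "submodule ?K R ?F" by (rule F.submodule_kernel[OF mod hom])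
  obtain G where G: "finite G" "G \<subseteq> syzygies R a b" "syzygies R a b \<subseteq> pair_span R G"
    using fg by (auto simp: syzygies_fg_def)
  have encG: "enc ` G \<subseteq> ?K"
  proof clarify
    fix x y assume "(x, y) \<in> G"
    then have "(x, y) \<in> syzygies R a b" using G(2) by blast
    then show "enc (x, y) \<in> ?K"
      using enc[of x y] by (simp add: mem_a_kernel mem_syzygies ideal_module_simps)
  qed
  have carr: "G \<subseteq> carrier R \<times> carrier R"
    using G(2) syzygies_subset by (rule subset_trans)
  have "?K \<subseteq> H" if H: "submodule H R ?F" "enc ` G \<subseteq> H" for H
  proof
    fix x assume x: "x \<in> ?K"
    then have xF: "x \<in> carrier ?F" and "x 0 \<otimes> a \<oplus> x (Suc 0) \<otimes> b = \<zero>"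
      by (auto simp: mem_a_kernel ideal_module_simps h_def)
    then have "(x 0, x (Suc 0)) \<in> syzygies R a b"
      using x01 by (simp add: mem_syzygies)
    then have "(x 0, x (Suc 0)) \<in> pair_span R G" using G(3) by blast
    moreover have "enc (y, z) \<in> H" if "(y, z) \<in> pair_span R G" for y z
      using that
    proof (induction rule: pair_span.induct)
      case zero
      have "enc (\<zero>, \<zero>) = \<zero>\<^bsub>?F\<^esub>" by (auto simp: enc_def free_module_simps)
      then show ?case
        using subgroup.one_closed[OF submodule.axioms(1)[OF H(1)]] by simp
    next
      case (step y z p q c)
      have eq: "enc (y \<oplus> c \<otimes> p, z \<oplus> c \<otimes> q) = enc (y, z) \<oplus>\<^bsub>?F\<^esub> c \<odot>\<^bsub>?F\<^esub> enc (p, q)"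
        by (auto simp: enc_def free_module_simps intro!: ext)
      show ?case
        unfolding eq using step H by (auto intro!: F.submoduleE(4,5)[OF H(1)])
    qed
    ultimately show "x \<in> H" using enc_dec[OF xF] by metis
  qed
  then have "?K \<subseteq> submodule_span R ?F (enc ` G)"
    by (auto simp: submodule_span_def)
  moreover have "submodule_span R ?F (enc ` G) \<subseteq> ?K"
    using sub encG by (auto simp: submodule_span_def)
  ultimately have "fg_submodule ?K R ?F"
    using sub encG G(1) unfolding fg_submodule_def by blast
  then show ?thesis
    using mod hom surj unfolding finitely_presented_def by blast
qed

end

text \<open>The bridge from the definition to all later arguments, which handle syzygies of pairs
  and never a presentation.\<close>

lemma finite_conductor_ring_iff:
  "finite_conductor_ring R \<longleftrightarrow>
    cring R \<and> (\<forall>a\<in>carrier R. \<forall>b\<in>carrier R. syzygies_fg R a b)"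
proof (cases "cring R")
  case True
  then interpret cring R .
  have "finitely_presented R (ideal_module R (Idl\<^bsub>R\<^esub> {a, b})) \<longleftrightarrow> syzygies_fg R a b"
    if "a \<in> carrier R" "b \<in> carrier R" for a b
    using that syzygies_fg_imp_finitely_presented finitely_presented_imp_syzygies_fg by metis
  then show ?thesis
    unfolding finite_conductor_ring_def two_generated_ideal_def by metis
qed (simp add: finite_conductor_ring_def)

text \<open>The images of generators generate because each syzygy over \<open>D\<close> is the image
  of one over \<open>A\<close>. This serves both for the quotient by the conductor and for the
  projection to a factor of the product.\<close>

lemma syzygies_fg_image:
  assumes p: "ring_hom_cring A D p"
    and ab: "a \<in> carrier A" "b \<in> carrier A"
    and lift: "\<And>x' y'. (x', y') \<in> syzygies D (p a) (p b) \<Longrightarrow>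
      \<exists>x y. (x, y) \<in> syzygies A a b \<and> p x = x' \<and> p y = y'"
    and fg: "syzygies_fg A a b"
  shows "syzygies_fg D (p a) (p b)"
proof -
  interpret ring_hom_cring A D p by fact
  obtain G where G: "finite G" "G \<subseteq> syzygies A a b" "syzygies A a b \<subseteq> pair_span A G"
    using fg by (auto simp: syzygies_fg_def)
  let ?G = "map_prod p p ` G"
  have carr: "x \<in> carrier A" "y \<in> carrier A" if "(x, y) \<in> G" for x y
    using G(2) that by (auto simp: syzygies_def)
  have carr': "G \<subseteq> carrier A \<times> carrier A" using carr by auto
  have mapsto: "map_prod p p z \<in> syzygies D (p a) (p b)" if z: "z \<in> syzygies A a b" for z
  proof -
    obtain x y where xy: "z = (x, y)" "x \<in> carrier A" "y \<in> carrier A" "x \<otimes>\<^bsub>A\<^esub> a \<oplus>\<^bsub>A\<^esub> y \<otimes>\<^bsub>A\<^esub> b = \<zero>\<^bsub>A\<^esub>"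
      using z by (auto simp: syzygies_def)
    have "p x \<otimes>\<^bsub>D\<^esub> p a \<oplus>\<^bsub>D\<^esub> p y \<otimes>\<^bsub>D\<^esub> p b = p (x \<otimes>\<^bsub>A\<^esub> a \<oplus>\<^bsub>A\<^esub> y \<otimes>\<^bsub>A\<^esub> b)"
      using xy(2,3) ab by simp
    then show ?thesis
      using xy ab by (simp add: mem_syzygies)
  qed
  have 1: "?G \<subseteq> syzygies D (p a) (p b)"
    by (rule image_subsetI, rule mapsto, rule subsetD[OF G(2)])
  have span: "(p x, p y) \<in> pair_span D ?G" if "(x, y) \<in> pair_span A G" for x y
    using that
  proof (induction rule: pair_span.induct)
    case zero
    then show ?case by (simp add: pair_span.zero)
  next
    case (step x y g h c)
    have "x \<in> carrier A" "y \<in> carrier A"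
      using R.pair_span_closed[OF step.hyps(1) carr'] by auto
    moreover have "(p g, p h) \<in> ?G" using step.hyps(2) by force
    ultimately show ?case
      using pair_span.step[OF step.IH, of "p g" "p h" "p c"] step.hyps carr by simp
  qed
  have "syzygies D (p a) (p b) \<subseteq> pair_span D ?G"
  proof clarify
    fix x' y' assume "(x', y') \<in> syzygies D (p a) (p b)"
    from lift[OF this] obtain x y where "(x, y) \<in> syzygies A a b" "p x = x'" "p y = y'" by blast
    then show "(x', y') \<in> pair_span D ?G"
      using span G(3) by blast
  qed
  with 1 G(1) show ?thesis by (auto simp: syzygies_fg_def)
qed

section \<open>Syzygies of zero, idempotent, unimodular and proportional pairs\<close>

context cring
begin

text \<open>This settles the one pair about which the condition on ideals says nothing; its syzygies
  are all of \<open>R\<close>^2.\<close>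

lemma syzygies_fg_zero: "syzygies_fg R \<zero> \<zero>"
proof -
  let ?G = "{(\<one>, \<zero>), (\<zero>, \<one>)}"
  have carr: "?G \<subseteq> carrier R \<times> carrier R" by simp
  have "(x, y) \<in> pair_span R ?G" if "(x, y) \<in> syzygies R \<zero> \<zero>" for x y
  proof -
    have "x \<in> carrier R" "y \<in> carrier R" using that by (auto simp: mem_syzygies)
    then show ?thesis
      using pair_span_add[OF carr pair_span_smult_gen[OF carr, of x \<one> \<zero>]
          pair_span_smult_gen[OF carr, of y \<zero> \<one>]] by simp
  qed
  then have "syzygies R \<zero> \<zero> \<subseteq> pair_span R ?G" by auto
  then show ?thesis
    unfolding syzygies_fg_def by (intro exI[of _ ?G]) (simp add: mem_syzygies)
qed

text \<open>The idempotent splits \<open>R\<close>^2 into the summands \<open>e R\<close>^2 and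
  \<open>(1 - e) R\<close>^2. The first component of a syzygy of the multiplied pair is a syzygy of
  (a, b); the second is arbitrary and is covered by the two added generators.\<close>

lemma syzygies_fg_idempotent:
  assumes e: "e \<in> carrier R" "e \<otimes> e = e" and ab: "a \<in> carrier R" "b \<in> carrier R"
    and fg: "syzygies_fg R a b"
  shows "syzygies_fg R (e \<otimes> a) (e \<otimes> b)"
proof -
  obtain G where G: "finite G" "G \<subseteq> syzygies R a b" "syzygies R a b \<subseteq> pair_span R G"
    using fg by (auto simp: syzygies_fg_def)
  let ?G = "G \<union> {(\<one> \<ominus> e, \<zero>), (\<zero>, \<one> \<ominus> e)}"
  have mem: "(x, y) \<in> syzygies R (e \<otimes> a) (e \<otimes> b) \<longleftrightarrow>
    x \<in> carrier R \<and> y \<in> carrier R \<and> e \<otimes> (x \<otimes> a \<oplus> y \<otimes> b) = \<zero>" for x y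
  proof -
    have "x \<otimes> (e \<otimes> a) \<oplus> y \<otimes> (e \<otimes> b) = e \<otimes> (x \<otimes> a \<oplus> y \<otimes> b)"
      if "x \<in> carrier R" "y \<in> carrier R"
      using that e(1) ab by algebra
    then show ?thesis by (auto simp: mem_syzygies)
  qed
  have "e \<otimes> ((\<one> \<ominus> e) \<otimes> c) = (e \<ominus> e \<otimes> e) \<otimes> c" if "c \<in> carrier R" for c
    using e(1) that by algebra
  then have e0: "e \<otimes> ((\<one> \<ominus> e) \<otimes> c) = \<zero>" if "c \<in> carrier R" for c
    using e that by (simp add: minus_eq r_neg)
  have G': "?G \<subseteq> syzygies R (e \<otimes> a) (e \<otimes> b)"
    using G(2) e e0 ab by (auto simp: mem mem_syzygies[of _ _ R a b] subset_iff)
  have carr: "?G \<subseteq> carrier R \<times> carrier R"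
    using G' syzygies_subset by (rule subset_trans)
  have "(x, y) \<in> pair_span R ?G" if "(x, y) \<in> syzygies R (e \<otimes> a) (e \<otimes> b)" for x y
  proof -
    have xy: "x \<in> carrier R" "y \<in> carrier R" "e \<otimes> (x \<otimes> a \<oplus> y \<otimes> b) = \<zero>"
      using that by (auto simp: mem)
    have "(e \<otimes> x) \<otimes> a \<oplus> (e \<otimes> y) \<otimes> b = e \<otimes> (x \<otimes> a \<oplus> y \<otimes> b)"
      using xy(1,2) e(1) ab by algebra
    then have "(e \<otimes> x, e \<otimes> y) \<in> syzygies R a b"
      using xy e by (simp add: mem_syzygies)
    then have 1: "(e \<otimes> x, e \<otimes> y) \<in> pair_span R ?G"
      using G(3) pair_span_mono[of _ _ R G ?G] by blast
    have 2: "(x \<otimes> (\<one> \<ominus> e), x \<otimes> \<zero>) \<in> pair_span R ?G"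
      by (rule pair_span_smult_gen[OF carr xy(1)]) simp
    have 3: "(y \<otimes> \<zero>, y \<otimes> (\<one> \<ominus> e)) \<in> pair_span R ?G"
      by (rule pair_span_smult_gen[OF carr xy(2)]) simp
    have eq: "e \<otimes> x \<oplus> (x \<otimes> (\<one> \<ominus> e) \<oplus> y \<otimes> \<zero>) = x"
      "e \<otimes> y \<oplus> (x \<otimes> \<zero> \<oplus> y \<otimes> (\<one> \<ominus> e)) = y"
      using xy(1,2) e(1) by algebra+
    show ?thesis
      using pair_span_add[OF carr 1 pair_span_add[OF carr 2 3]] unfolding eq .
  qed
  then have "syzygies R (e \<otimes> a) (e \<otimes> b) \<subseteq> pair_span R ?G" by auto
  moreover have "finite ?G" using G(1) by simp
  ultimately show ?thesis using G' unfolding syzygies_fg_def by blast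
qed

text \<open>The coefficient of (v, -u) is found by pairing (x, y) with (q, -p), since this pairing
  sends (v, -u) to p u + q v = 1. Both identities hold up to a multiple of the relation x u + y v =
  0.\<close>

lemma syzygy_unimodular:
  assumes uv: "u \<in> carrier R" "v \<in> carrier R" and pq: "p \<in> carrier R" "q \<in> carrier R"
    and one: "p \<otimes> u \<oplus> q \<otimes> v = \<one>"
    and xy: "x \<in> carrier R" "y \<in> carrier R" "x \<otimes> u \<oplus> y \<otimes> v = \<zero>"
  shows "(q \<otimes> x \<ominus> p \<otimes> y) \<otimes> v = x" "(q \<otimes> x \<ominus> p \<otimes> y) \<otimes> (\<ominus> u) = y"
proof -
  have "(q \<otimes> x \<ominus> p \<otimes> y) \<otimes> v = (p \<otimes> u \<oplus> q \<otimes> v) \<otimes> x \<ominus> p \<otimes> (x \<otimes> u \<oplus> y \<otimes> v)"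
    using uv pq xy(1,2) by algebra
  then show "(q \<otimes> x \<ominus> p \<otimes> y) \<otimes> v = x"
    using one xy pq by (simp add: minus_eq)
  have "(q \<otimes> x \<ominus> p \<otimes> y) \<otimes> (\<ominus> u) = (p \<otimes> u \<oplus> q \<otimes> v) \<otimes> y \<ominus> q \<otimes> (x \<otimes> u \<oplus> y \<otimes> v)"
    using uv pq xy(1,2) by algebra
  then show "(q \<otimes> x \<ominus> p \<otimes> y) \<otimes> (\<ominus> u) = y"
    using one xy pq by (simp add: minus_eq)
qed

lemma syzygies_fg_unimodular:
  assumes uv: "u \<in> carrier R" "v \<in> carrier R" and pq: "p \<in> carrier R" "q \<in> carrier R"
    and one: "p \<otimes> u \<oplus> q \<otimes> v = \<one>"
  shows "syzygies_fg R u v"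
proof -
  have carr: "{(v, \<ominus> u)} \<subseteq> carrier R \<times> carrier R" using uv by simp
  have "v \<otimes> u \<oplus> (\<ominus> u) \<otimes> v = \<zero>" using uv by algebra
  then have "{(v, \<ominus> u)} \<subseteq> syzygies R u v" using uv by (simp add: mem_syzygies)
  moreover have "(x, y) \<in> pair_span R {(v, \<ominus> u)}" if "(x, y) \<in> syzygies R u v" for x y
    using that syzygy_unimodular[OF uv pq one, of x y]
      pair_span_smult_gen[OF carr, of "q \<otimes> x \<ominus> p \<otimes> y" v "\<ominus> u"] pq
    by (auto simp: mem_syzygies)
  then have "syzygies R u v \<subseteq> pair_span R {(v, \<ominus> u)}" by auto
  ultimately show ?thesis
    unfolding syzygies_fg_def by blast
qed

text \<open>Multiplying the relation x a + y b = 0 by \<open>r\<close> loses nothing, by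
  \<open>ann\<close>, and turns a and b into s u and s v. The factor \<open>s\<close> is left in
  place because it may be a zero divisor; how to remove it depends on the ring at hand.\<close>

lemma syzygies_cancel:
  assumes "r \<in> carrier R" "s \<in> carrier R" "a \<in> carrier R" "b \<in> carrier R"
    "u \<in> carrier R" "v \<in> carrier R"
    and eq: "r \<otimes> a = s \<otimes> u" "r \<otimes> b = s \<otimes> v"
    and ann: "\<And>z. z \<in> carrier R \<Longrightarrow> r \<otimes> z = \<zero> \<longleftrightarrow> z = \<zero>"
  shows "syzygies R a b =
    {(x, y) \<in> carrier R \<times> carrier R. s \<otimes> (x \<otimes> u \<oplus> y \<otimes> v) = \<zero>}"
proof -
  have "x \<otimes> a \<oplus> y \<otimes> b = \<zero> \<longleftrightarrow> s \<otimes> (x \<otimes> u \<oplus> y \<otimes> v) = \<zero>"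
    if xy: "x \<in> carrier R" "y \<in> carrier R" for x y
  proof -
    have "r \<otimes> (x \<otimes> a \<oplus> y \<otimes> b) = x \<otimes> (r \<otimes> a) \<oplus> y \<otimes> (r \<otimes> b)"
      using xy assms(1-6) by algebra
    also have "\<dots> = s \<otimes> (x \<otimes> u \<oplus> y \<otimes> v)"
      unfolding eq using xy assms(1-6) by algebra
    finally show ?thesis
      using ann[of "x \<otimes> a \<oplus> y \<otimes> b"] xy assms by simp
  qed
  then show ?thesis by (auto simp: syzygies_def)
qed

end

section \<open>Products of integral domains\<close>

locale product_decomposition = cring A
  for A :: "('a, 'x) ring_scheme" (structure) and \<Lambda> :: "'l set" and D :: "'l \<Rightarrow> 'd ring" and f +
  assumes domains: "\<And>i. i \<in> \<Lambda> \<Longrightarrow> domain (D i)"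
    and iso: "f \<in> ring_iso A (product_ring \<Lambda> D)"
begin

lemma proj_ring_hom:
  assumes i: "i \<in> \<Lambda>"
  shows "ring_hom_cring A (D i) (\<lambda>x. f x i)"
proof -
  have f: "f \<in> ring_hom A (product_ring \<Lambda> D)" using iso by (simp add: ring_iso_def)
  interpret d: domain "D i" by (rule domains[OF i])
  have "(\<lambda>x. f x i) \<in> ring_hom A (D i)"
    using ring_hom_memE[OF f] i by (intro ring_hom_memI) (auto simp: product_ring_def PiE_iff)
  then show ?thesis
    by (intro ring_hom_cringI is_cring d.is_cring)
qed

lemma proj_surj:
  assumes "\<And>i. i \<in> \<Lambda> \<Longrightarrow> g i \<in> carrier (D i)"
  obtains x where "x \<in> carrier A" "\<And>i. i \<in> \<Lambda> \<Longrightarrow> f x i = g i"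
proof -
  have "restrict g \<Lambda> \<in> f ` carrier A"
    using iso assms by (auto simp: ring_iso_def bij_betw_def product_ring_def)
  then obtain x where "x \<in> carrier A" "restrict g \<Lambda> = f x" by blast
  then show ?thesis using that by (metis restrict_apply')
qed

lemma proj_eq_zero_iff:
  assumes x: "x \<in> carrier A"
  shows "x = \<zero> \<longleftrightarrow> (\<forall>i\<in>\<Lambda>. f x i = \<zero>\<^bsub>D i\<^esub>)"
proof -
  have z: "f \<zero> i = \<zero>\<^bsub>D i\<^esub>" if "i \<in> \<Lambda>" for i
    using ring_hom_cring.hom_zero[OF proj_ring_hom[OF that]] .
  have "f y \<in> extensional \<Lambda>" if "y \<in> carrier A" for y
    using iso that by (auto simp: ring_iso_def bij_betw_def product_ring_def PiE_iff)
  then have "(\<forall>i\<in>\<Lambda>. f x i = \<zero>\<^bsub>D i\<^esub>) \<longleftrightarrow> f x = f \<zero>"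
    using x z by (metis zero_closed extensionalityI)
  also have "\<dots> \<longleftrightarrow> x = \<zero>"
    using iso x by (auto simp: ring_iso_def bij_betw_def inj_on_def)
  finally show ?thesis by blast
qed

text \<open>The element is the indicator function of the factors where \<open>P\<close> holds,
  pulled back along \<open>f\<close>. Its annihilator is what later arguments use, so the statement
  describes that instead of its coordinates.\<close>

lemma indicator_idempotent:
  obtains e where "e \<in> carrier A" "e \<otimes> e = e"
    "\<And>z. z \<in> carrier A \<Longrightarrow> e \<otimes> z = \<zero> \<longleftrightarrow> (\<forall>i\<in>\<Lambda>. P i \<longrightarrow> f z i = \<zero>\<^bsub>D i\<^esub>)"
proof -
  have d: "ring (D i)" if "i \<in> \<Lambda>" for i using domains[OF that] by (simp add: domain_def cring_def)
  obtain e where e: "e \<in> carrier A" "\<And>i. i \<in> \<Lambda> \<Longrightarrow> f e i = (if P i then \<one>\<^bsub>D i\<^esub> else \<zero>\<^bsub>D i\<^esub>)"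
  proof (rule proj_surj[of "\<lambda>i. if P i then \<one>\<^bsub>D i\<^esub> else \<zero>\<^bsub>D i\<^esub>"])
    show "(if P i then \<one>\<^bsub>D i\<^esub> else \<zero>\<^bsub>D i\<^esub>) \<in> carrier (D i)" if "i \<in> \<Lambda>" for i
      using ring.ring_simprules(2,6)[OF d[OF that]] by simp
  qed blast
  have mult: "f (e \<otimes> z) i = (if P i then f z i else \<zero>\<^bsub>D i\<^esub>)" if "i \<in> \<Lambda>" "z \<in> carrier A" for z i
  proof -
    interpret h: ring_hom_cring A "D i" "\<lambda>x. f x i" by (rule proj_ring_hom[OF that(1)])
    show ?thesis using that e h.hom_closed[OF that(2)] by simp
  qed
  show ?thesis
  proof (rule that[OF e(1)])
    show ez: "e \<otimes> z = \<zero> \<longleftrightarrow> (\<forall>i\<in>\<Lambda>. P i \<longrightarrow> f z i = \<zero>\<^bsub>D i\<^esub>)" if "z \<in> carrier A" for z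
      using proj_eq_zero_iff[of "e \<otimes> z"] that e(1) mult by auto
    have "e \<otimes> e \<ominus> e = \<zero>"
    proof -
      have "f (e \<otimes> e \<ominus> e) i = \<zero>\<^bsub>D i\<^esub>" if i: "i \<in> \<Lambda>" for i
      proof -
        interpret h: ring_hom_cring A "D i" "\<lambda>x. f x i" by (rule proj_ring_hom[OF i])
        show ?thesis
          using mult[OF i e(1)] e h.hom_closed[OF e(1)] i
          by (simp add: minus_eq h.S.r_neg del: h.hom_mult)
      qed
      then show ?thesis using proj_eq_zero_iff[of "e \<otimes> e \<ominus> e"] e(1) by simp
    qed
    then show "e \<otimes> e = e" using e(1) by simp
  qed
qed

text \<open>A product in a domain vanishes only if one of its factors does. Hence \<open>s\<close>
  annihilates exactly what vanishes on the support of \<open>s\<close>, and so does the indicator of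
  this support.\<close>

lemma annihilator_idempotent:
  assumes s: "s \<in> carrier A"
  obtains e where "e \<in> carrier A" "e \<otimes> e = e"
    "\<And>z. z \<in> carrier A \<Longrightarrow> e \<otimes> z = \<zero> \<longleftrightarrow> s \<otimes> z = \<zero>"
proof -
  obtain e where e: "e \<in> carrier A" "e \<otimes> e = e"
    "\<And>z. z \<in> carrier A \<Longrightarrow> e \<otimes> z = \<zero> \<longleftrightarrow> (\<forall>i\<in>\<Lambda>. f s i \<noteq> \<zero>\<^bsub>D i\<^esub> \<longrightarrow> f z i = \<zero>\<^bsub>D i\<^esub>)"
    using indicator_idempotent[of "\<lambda>i. f s i \<noteq> \<zero>\<^bsub>D i\<^esub>"] by blast
  have "(\<forall>i\<in>\<Lambda>. f s i \<noteq> \<zero>\<^bsub>D i\<^esub> \<longrightarrow> f z i = \<zero>\<^bsub>D i\<^esub>) \<longleftrightarrow> s \<otimes> z = \<zero>" if z: "z \<in> carrier A" for z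
  proof -
    have "f (s \<otimes> z) i = \<zero>\<^bsub>D i\<^esub> \<longleftrightarrow> f s i = \<zero>\<^bsub>D i\<^esub> \<or> f z i = \<zero>\<^bsub>D i\<^esub>" if i: "i \<in> \<Lambda>" for i
    proof -
      interpret h: ring_hom_cring A "D i" "\<lambda>x. f x i" by (rule proj_ring_hom[OF i])
      interpret d: domain "D i" by (rule domains[OF i])
      show ?thesis
        using s z h.hom_closed[OF s] h.hom_closed[OF z] by (simp add: d.integral_iff)
    qed
    then show ?thesis
      using proj_eq_zero_iff[of "s \<otimes> z"] s z by auto
  qed
  with e show ?thesis using that by simp
qed

text \<open>A pair over \<open>D i\<close> is lifted to \<open>A\<close> and multiplied by the
  idempotent \<open>e\<close> of this factor. The other coordinates then impose no condition, so
  arbitrary lifts of the entries of a syzygy over \<open>D i\<close> form a syzygy over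
  \<open>A\<close>.\<close>

lemma finite_conductor_ring_factor:
  assumes fc: "finite_conductor_ring A" and i: "i \<in> \<Lambda>"
  shows "finite_conductor_ring (D i)"
proof -
  interpret h: ring_hom_cring A "D i" "\<lambda>x. f x i" by (rule proj_ring_hom[OF i])
  obtain e where e: "e \<in> carrier A" "e \<otimes> e = e"
    "\<And>z. z \<in> carrier A \<Longrightarrow> e \<otimes> z = \<zero> \<longleftrightarrow> (\<forall>j\<in>\<Lambda>. j = i \<longrightarrow> f z j = \<zero>\<^bsub>D j\<^esub>)"
    using indicator_idempotent[of "\<lambda>j. j = i"] by blast
  then have ez: "e \<otimes> z = \<zero> \<longleftrightarrow> f z i = \<zero>\<^bsub>D i\<^esub>" if "z \<in> carrier A" for z
    using that i by simp
  have surj: "\<exists>x\<in>carrier A. f x i = y" if y: "y \<in> carrier (D i)" for y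
  proof -
    have "(if j = i then y else \<zero>\<^bsub>D j\<^esub>) \<in> carrier (D j)" if "j \<in> \<Lambda>" for j
      using y ring_hom_cring.axioms(2)[OF proj_ring_hom[OF that]]
      by (simp add: cring_def ring.ring_simprules)
    from proj_surj[OF this] show ?thesis using i by metis
  qed
  \<comment> \<open>Only the annihilator of \<open>e\<close> is known. It contains x - e x by
    idempotence, so this difference vanishes at \<open>i\<close>.\<close>
  have fe: "f (e \<otimes> x) i = f x i" if x: "x \<in> carrier A" for x
  proof -
    have "e \<otimes> (x \<ominus> e \<otimes> x) = (e \<ominus> e \<otimes> e) \<otimes> x" using x e(1) by algebra
    then have "f (x \<ominus> e \<otimes> x) i = \<zero>\<^bsub>D i\<^esub>"
      using ez[of "x \<ominus> e \<otimes> x"] x e(1,2) by (simp add: minus_eq r_neg)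
    then have "f x i \<ominus>\<^bsub>D i\<^esub> f (e \<otimes> x) i = \<zero>\<^bsub>D i\<^esub>"
      using x e(1) by (simp add: minus_eq h.S.minus_eq)
    then show ?thesis
      using x e(1) h.hom_closed by (metis h.S.r_right_minus_eq m_closed)
  qed
  have "syzygies_fg (D i) a' b'" if a': "a' \<in> carrier (D i)" and b': "b' \<in> carrier (D i)" for a' b'
  proof -
    obtain a b where ab: "a \<in> carrier A" "b \<in> carrier A" and a'b': "f a i = a'" "f b i = b'"
      using surj[OF a'] surj[OF b'] by blast
    have "syzygies_fg (D i) (f (e \<otimes> a) i) (f (e \<otimes> b) i)"
    proof (rule syzygies_fg_image[OF proj_ring_hom[OF i]])
      show "e \<otimes> a \<in> carrier A" "e \<otimes> b \<in> carrier A" using e(1) ab by auto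
      then show "syzygies_fg A (e \<otimes> a) (e \<otimes> b)"
        using fc by (simp add: finite_conductor_ring_iff)
    next
      fix x' y' assume "(x', y') \<in> syzygies (D i) (f (e \<otimes> a) i) (f (e \<otimes> b) i)"
      then have xy': "x' \<in> carrier (D i)" "y' \<in> carrier (D i)"
        "x' \<otimes>\<^bsub>D i\<^esub> f a i \<oplus>\<^bsub>D i\<^esub> y' \<otimes>\<^bsub>D i\<^esub> f b i = \<zero>\<^bsub>D i\<^esub>"
        using fe ab by (simp_all add: mem_syzygies)
      obtain x y where xy: "x \<in> carrier A" "y \<in> carrier A" "f x i = x'" "f y i = y'"
        using surj[OF xy'(1)] surj[OF xy'(2)] by blast
      then have "f (x \<otimes> a \<oplus> y \<otimes> b) i = \<zero>\<^bsub>D i\<^esub>" using xy'(3) ab by simp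
      then have "e \<otimes> (x \<otimes> a \<oplus> y \<otimes> b) = \<zero>" using ez xy ab by simp
      moreover have "x \<otimes> (e \<otimes> a) \<oplus> y \<otimes> (e \<otimes> b) = e \<otimes> (x \<otimes> a \<oplus> y \<otimes> b)"
        using xy(1,2) e(1) ab by algebra
      ultimately have "(x, y) \<in> syzygies A (e \<otimes> a) (e \<otimes> b)"
        using xy by (simp add: mem_syzygies)
      then show "\<exists>x y. (x, y) \<in> syzygies A (e \<otimes> a) (e \<otimes> b) \<and> f x i = x' \<and> f y i = y'"
        using xy by blast
    qed
    then show ?thesis using fe ab a'b' by simp
  qed
  then show ?thesis
    by (simp add: finite_conductor_ring_iff h.S.cring_axioms)
qed

end

section \<open>Tensor relations and flatness\<close>

text \<open>Flatness is stated with test modules over the type \<open>(nat \<Rightarrow> 'a) set\<close>, so ideals of \<open>R\<close> have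
  to be transported there.\<close>

definition module_image :: "('m \<Rightarrow> 'u) \<Rightarrow> ('r, 'm, 'y) module_scheme \<Rightarrow> ('r, 'u) module"
  where "module_image g M =
    \<lparr>carrier = g ` carrier M,
     monoid.mult = (\<lambda>x y. g (inv_into UNIV g x \<otimes>\<^bsub>M\<^esub> inv_into UNIV g y)), one = g \<one>\<^bsub>M\<^esub>,
     ring.zero = g \<zero>\<^bsub>M\<^esub>, add = (\<lambda>x y. g (inv_into UNIV g x \<oplus>\<^bsub>M\<^esub> inv_into UNIV g y)),
     smult = (\<lambda>a x. g (a \<odot>\<^bsub>M\<^esub> inv_into UNIV g x))\<rparr>"

lemma module_image_simps:
  "carrier (module_image g M) = g ` carrier M"
  "\<zero>\<^bsub>module_image g M\<^esub> = g \<zero>\<^bsub>M\<^esub>"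
  "x \<oplus>\<^bsub>module_image g M\<^esub> y = g (inv_into UNIV g x \<oplus>\<^bsub>M\<^esub> inv_into UNIV g y)"
  "a \<odot>\<^bsub>module_image g M\<^esub> x = g (a \<odot>\<^bsub>M\<^esub> inv_into UNIV g x)"
  by (simp_all add: module_image_def)

lemma (in module) module_image:
  assumes g: "inj g"
  shows "module R (module_image g M)"
proof -
  have "abelian_group (module_image g M)"
  proof (rule abelian_groupI)
    fix x assume "x \<in> carrier (module_image g M)"
    then obtain y where y: "y \<in> carrier M" "x = g y" by (auto simp: module_image_simps)
    then show "\<exists>y\<in>carrier (module_image g M). y \<oplus>\<^bsub>module_image g M\<^esub> x = \<zero>\<^bsub>module_image g M\<^esub>"
      using g by (intro bexI[of _ "g (\<ominus>\<^bsub>M\<^esub> y)"]) (auto simp: module_image_simps M.l_neg)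
  qed (use g in \<open>auto simp: module_image_simps M.a_ac\<close>)
  then show ?thesis
    by (intro moduleI is_cring)
      (use g in \<open>auto simp: module_image_simps smult_l_distr smult_r_distr smult_assoc1\<close>)
qed

section \<open>Formal sums and the relations of the tensor product\<close>

lemma keys_diff_subset:
  "Poly_Mapping.keys a \<subseteq> S \<Longrightarrow> Poly_Mapping.keys b \<subseteq> S \<Longrightarrow> Poly_Mapping.keys (a - b) \<subseteq> S"
  using keys_diff[of a b] by blast

lemma tensor_generators_closed:
  assumes "module R M" "module R N"
  shows "x \<in> carrier M \<Longrightarrow> x' \<in> carrier M \<Longrightarrow> y \<in> carrier N \<Longrightarrow>
      frag_of (x \<oplus>\<^bsub>M\<^esub> x', y) - frag_of (x, y) - frag_of (x', y)
        \<in> carrier (free_Abelian_group (carrier M \<times> carrier N))"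
    and "x \<in> carrier M \<Longrightarrow> y \<in> carrier N \<Longrightarrow> y' \<in> carrier N \<Longrightarrow>
      frag_of (x, y \<oplus>\<^bsub>N\<^esub> y') - frag_of (x, y) - frag_of (x, y')
        \<in> carrier (free_Abelian_group (carrier M \<times> carrier N))"
    and "a \<in> carrier R \<Longrightarrow> x \<in> carrier M \<Longrightarrow> y \<in> carrier N \<Longrightarrow>
      frag_of (a \<odot>\<^bsub>M\<^esub> x, y) - frag_of (x, a \<odot>\<^bsub>N\<^esub> y)
        \<in> carrier (free_Abelian_group (carrier M \<times> carrier N))"
proof -
  interpret M: module R M by fact
  interpret N: module R N by fact
  show "x \<in> carrier M \<Longrightarrow> x' \<in> carrier M \<Longrightarrow> y \<in> carrier N \<Longrightarrow>
      frag_of (x \<oplus>\<^bsub>M\<^esub> x', y) - frag_of (x, y) - frag_of (x', y)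
        \<in> carrier (free_Abelian_group (carrier M \<times> carrier N))"
    by (simp add: keys_diff_subset)
  show "x \<in> carrier M \<Longrightarrow> y \<in> carrier N \<Longrightarrow> y' \<in> carrier N \<Longrightarrow>
      frag_of (x, y \<oplus>\<^bsub>N\<^esub> y') - frag_of (x, y) - frag_of (x, y')
        \<in> carrier (free_Abelian_group (carrier M \<times> carrier N))"
    by (simp add: keys_diff_subset)
  show "a \<in> carrier R \<Longrightarrow> x \<in> carrier M \<Longrightarrow> y \<in> carrier N \<Longrightarrow>
      frag_of (a \<odot>\<^bsub>M\<^esub> x, y) - frag_of (x, a \<odot>\<^bsub>N\<^esub> y)
        \<in> carrier (free_Abelian_group (carrier M \<times> carrier N))"
    by (simp add: keys_diff_subset)
qed

lemma tensor_relations_subgroup: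
  assumes "module R M" "module R N"
  shows "subgroup (tensor_relations R M N) (free_Abelian_group (carrier M \<times> carrier N))"
  unfolding tensor_relations_def
  by (rule group.generate_is_subgroup[OF group_free_Abelian_group])
    (use tensor_generators_closed[OF assms] in blast)

lemma tensor_relations_intros:
  shows "x \<in> carrier M \<Longrightarrow> x' \<in> carrier M \<Longrightarrow> y \<in> carrier N \<Longrightarrow>
      frag_of (x \<oplus>\<^bsub>M\<^esub> x', y) - frag_of (x, y) - frag_of (x', y) \<in> tensor_relations R M N"
    and "x \<in> carrier M \<Longrightarrow> y \<in> carrier N \<Longrightarrow> y' \<in> carrier N \<Longrightarrow>
      frag_of (x, y \<oplus>\<^bsub>N\<^esub> y') - frag_of (x, y) - frag_of (x, y') \<in> tensor_relations R M N"
    and "a \<in> carrier R \<Longrightarrow> x \<in> carrier M \<Longrightarrow> y \<in> carrier N \<Longrightarrow>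
      frag_of (a \<odot>\<^bsub>M\<^esub> x, y) - frag_of (x, a \<odot>\<^bsub>N\<^esub> y) \<in> tensor_relations R M N"
  unfolding tensor_relations_def by (rule generate.incl, blast)+

text \<open>The members of the free abelian group that satisfy \<open>P\<close> form a subgroup
  containing the bilinearity relations. The conditions on keys in the group cases keep the sums
  inside this free group, where the laws of a homomorphism on it can be applied.\<close>

lemma tensor_relations_induct [consumes 3, case_names zero uminus add l_distr r_distr balanced]:
  assumes w: "w \<in> tensor_relations R M N" and M: "module R M" and N: "module R N"
    and zero: "P 0"
    and uminus: "\<And>w. Poly_Mapping.keys w \<subseteq> carrier M \<times> carrier N \<Longrightarrow> P w \<Longrightarrow> P (- w)"
    and add: "\<And>w w'. Poly_Mapping.keys w \<subseteq> carrier M \<times> carrier N \<Longrightarrow>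
      Poly_Mapping.keys w' \<subseteq> carrier M \<times> carrier N \<Longrightarrow> P w \<Longrightarrow> P w' \<Longrightarrow> P (w + w')"
    and l_distr: "\<And>x x' y. x \<in> carrier M \<Longrightarrow> x' \<in> carrier M \<Longrightarrow> y \<in> carrier N \<Longrightarrow>
      P (frag_of (x \<oplus>\<^bsub>M\<^esub> x', y) - frag_of (x, y) - frag_of (x', y))"
    and r_distr: "\<And>x y y'. x \<in> carrier M \<Longrightarrow> y \<in> carrier N \<Longrightarrow> y' \<in> carrier N \<Longrightarrow>
      P (frag_of (x, y \<oplus>\<^bsub>N\<^esub> y') - frag_of (x, y) - frag_of (x, y'))"
    and balanced: "\<And>a x y. a \<in> carrier R \<Longrightarrow> x \<in> carrier M \<Longrightarrow> y \<in> carrier N \<Longrightarrow>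
      P (frag_of (a \<odot>\<^bsub>M\<^esub> x, y) - frag_of (x, a \<odot>\<^bsub>N\<^esub> y))"
  shows "P w"
proof -
  let ?F = "free_Abelian_group (carrier M \<times> carrier N)"
  interpret F: group ?F by simp
  have "subgroup {w \<in> carrier ?F. P w} ?F"
  proof (rule F.subgroupI)
    show "{w \<in> carrier ?F. P w} \<noteq> {}" using zero by force
  next
    fix a assume "a \<in> {w \<in> carrier ?F. P w}"
    then show "inv\<^bsub>?F\<^esub> a \<in> {w \<in> carrier ?F. P w}" using uminus by simp
  next
    fix a b assume "a \<in> {w \<in> carrier ?F. P w}" "b \<in> {w \<in> carrier ?F. P w}"
    then show "a \<otimes>\<^bsub>?F\<^esub> b \<in> {w \<in> carrier ?F. P w}"
      using add[of a b] keys_add[of a b] by auto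
  qed auto
  then have "tensor_relations R M N \<subseteq> {w \<in> carrier ?F. P w}"
    unfolding tensor_relations_def
    by (rule F.generate_subgroup_incl[rotated])
      (use tensor_generators_closed[OF M N] l_distr r_distr balanced in blast)
  then show ?thesis using w by blast
qed

text \<open>This restates injectivity of the tensor map, which concerns cosets, for formal sums. The
  zero coset and the coset of \<open>w\<close> are both sent to the zero coset, so they coincide and
  \<open>w\<close> is a relation.\<close>

lemma flat_tensor_relations:
  fixes M' M :: "('r, 'u) module"
  assumes flat: "flat_module TYPE('u) R N" and M': "module R M'" and M: "module R M"
    and f: "f \<in> module_hom R M' M" "inj_on f (carrier M')"
    and w: "Poly_Mapping.keys w \<subseteq> carrier M' \<times> carrier N"
    and image: "frag_extend (\<lambda>(x, y). frag_of (f x, y)) w \<in> tensor_relations R M N"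
  shows "w \<in> tensor_relations R M' N"
proof -
  have N: "module R N" using flat by (simp add: flat_module_def)
  note hom = module_homD[OF f(1)]
  let ?F' = "free_Abelian_group (carrier M' \<times> carrier N)" and ?H' = "tensor_relations R M' N"
  let ?F = "free_Abelian_group (carrier M \<times> carrier N)" and ?H = "tensor_relations R M N"
  let ?f = "frag_extend (\<lambda>(x, y). frag_of (f x, y))"
  interpret F': group ?F' by simp
  interpret F: group ?F by simp
  have H': "subgroup ?H' ?F'" by (rule tensor_relations_subgroup[OF M' N])
  have H: "subgroup ?H ?F" by (rule tensor_relations_subgroup[OF M N])
  have H_minus: "- v \<in> ?H" if "v \<in> ?H" for v
    using subgroup.m_inv_closed[OF H that] subgroup.mem_carrier[OF H that] by simp
  have H_plus: "v + v' \<in> ?H" if "v \<in> ?H" "v' \<in> ?H" for v v'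
    using subgroup.m_closed[OF H that] by simp
  \<comment> \<open>Each defining relation over \<open>M'\<close> goes to the relation of the same
    kind over \<open>M\<close>, because \<open>f\<close> is linear.\<close>
  have rel: "?f v \<in> ?H" if "v \<in> ?H'" for v
    using that M' N
  proof (induction rule: tensor_relations_induct)
    case zero
    then show ?case using subgroup.one_closed[OF H] by simp
  next
    case (uminus w)
    then show ?case using H_minus by (simp add: frag_extend_minus)
  next
    case (add w w')
    then show ?case using H_plus by (simp add: frag_extend_add)
  next
    case (l_distr x x' y)
    then show ?case
      using tensor_relations_intros(1)[of "f x" M "f x'" y N R] hom by (simp add: frag_extend_diff)
  next
    case (r_distr x y y')
    then show ?case
      using tensor_relations_intros(2)[of "f x" M y N y' R] hom by (simp add: frag_extend_diff)
  next
    case (balanced a x y)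
    then show ?case
      using tensor_relations_intros(3)[of a R "f x" M y N] hom by (simp add: frag_extend_diff)
  qed
  \<comment> \<open>\<open>tensor_map\<close> is a union over the members of \<open>K\<close>. If
    every member lands in \<open>?H\<close>, each piece of the union is the coset \<open>?H\<close>
    itself.\<close>
  have coset: "tensor_map R f M N K = ?H" if "K \<noteq> {}" and K: "\<And>v. v \<in> K \<Longrightarrow> ?f v \<in> ?H" for K
  proof -
    have "?H #>\<^bsub>?F\<^esub> ?f v = ?H" if "v \<in> K" for v
      using F.coset_join2[OF _ H K[OF that]] subgroup.mem_carrier[OF H K[OF that]] by simp
    then show ?thesis using \<open>K \<noteq> {}\<close> by (auto simp: tensor_map_def)
  qed
  have wF: "w \<in> carrier ?F'" using w by simp
  let ?K = "?H' #>\<^bsub>?F'\<^esub> w"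
  have self: "w \<in> ?K" by (rule F'.rcos_self[OF wF H'])
  have "?H' #>\<^bsub>?F'\<^esub> \<one>\<^bsub>?F'\<^esub> = ?H'"
    by (rule F'.coset_join2[OF F'.one_closed H' subgroup.one_closed[OF H']])
  then have "?H' \<in> carrier (tensor_product R M' N)"
    unfolding tensor_product_def FactGroup_def RCOSETS_def by (simp, metis F'.one_closed carrier_free_Abelian_group_iff one_free_Abelian_group)
  moreover have "?K \<in> carrier (tensor_product R M' N)"
    using wF by (auto simp: tensor_product_def FactGroup_def RCOSETS_def)
  moreover have "tensor_map R f M N ?H' = ?H"
    by (rule coset) (use subgroup.one_closed[OF H'] rel in auto)
  moreover have "tensor_map R f M N ?K = ?H"
  proof (rule coset)
    show "?K \<noteq> {}" using self by blast
    fix v assume "v \<in> ?K"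
    then obtain h where "h \<in> ?H'" "v = h + w" by (auto simp: r_coset_def)
    then show "?f v \<in> ?H" using rel image H_plus by (simp add: frag_extend_add)
  qed
  moreover have "inj_on (tensor_map R f M N) (carrier (tensor_product R M' N))"
    using flat M' M f unfolding flat_module_def by blast
  ultimately have "?H' = ?K" by (metis inj_onD)
  then show ?thesis using self by simp
qed

section \<open>Conductor squares\<close>

lemma (in ideal) rcos_zero_iff:
  assumes "x \<in> carrier R"
  shows "I +> x = \<zero>\<^bsub>R Quot I\<^esub> \<longleftrightarrow> x \<in> I"
proof -
  have "I +> x = I \<longleftrightarrow> x \<in> I"
    using a_rcos_self[OF assms] a_coset_join2[OF assms a_subgroup] by blast
  then show ?thesis by (simp add: FactRing_def)
qed

locale conductor_ideal = cring T
  for T :: "('a, 'x) ring_scheme" (structure) +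
  fixes R C
  assumes subcring: "subcring R T" and common: "common_ideal C R T"
begin

abbreviation "RR \<equiv> subring_of T R"

sublocale RR: cring RR
  using subcring subcring_iff[OF subcringE(1)[OF subcring]] by simp

sublocale C: ideal C T
  using common by (simp add: common_ideal_def)

sublocale CR: ideal C RR
  using common by (simp add: common_ideal_def)

lemmas R_simps [simp, intro] = subcringE(2,3,5-7)[OF subcring]

lemma R_carrier [simp, intro]: "x \<in> R \<Longrightarrow> x \<in> carrier T"
  using subcringE(1)[OF subcring] by blast

lemma C_R [simp, intro]: "x \<in> C \<Longrightarrow> x \<in> R"
  using CR.Icarr by simp

lemma R_minus [simp, intro]: "x \<in> R \<Longrightarrow> y \<in> R \<Longrightarrow> x \<ominus> y \<in> R"
  by (simp add: minus_eq)

lemma mem_syzygies_RR: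
  "(x, y) \<in> syzygies RR a b \<longleftrightarrow> x \<in> R \<and> y \<in> R \<and> x \<otimes> a \<oplus> y \<otimes> b = \<zero>"
  by (simp add: mem_syzygies)

text \<open>Flatness makes \<open>(v, -u)\<close> a \<open>T\<close>-combination of syzygies over \<open>R\<close>, and \<open>C\<close> absorbs the
  coefficients. In the proof, \<open>J\<close> is the ideal of those \<open>t\<close> for which the claim holds for \<open>t (v, -u)\<close>
  in place of \<open>(v, -u)\<close>. The element \<open>u \<otimes> v - v \<otimes> u\<close> of the tensor product of the ideal \<open>(u, v)\<close>
  of \<open>R\<close> with \<open>T\<close> is zero by flatness. The map \<open>(x u + y v) \<otimes> t \<mapsto> (q x - p y) t\<close> is well defined
  modulo \<open>J\<close> and sends this element to \<open>1\<close>, so \<open>1 \<in> J\<close>.\<close>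

lemma flat_syzygies:
  assumes flat: "flat_module TYPE((nat \<Rightarrow> 'a) set) RR (regular_module T)"
    and uv: "u \<in> R" "v \<in> R" and pq: "p \<in> carrier T" "q \<in> carrier T"
    and one: "p \<otimes> u \<oplus> q \<otimes> v = \<one>"
  obtains G where "finite G" "G \<subseteq> syzygies RR u v"
    "\<And>c. c \<in> C \<Longrightarrow> (c \<otimes> v, \<ominus> (c \<otimes> u)) \<in> pair_span RR G"
proof -
  define J where "J = {t \<in> carrier T. \<exists>G. finite G \<and> G \<subseteq> syzygies RR u v \<and>
    (\<forall>c\<in>C. ((c \<otimes> t) \<otimes> v, \<ominus> ((c \<otimes> t) \<otimes> u)) \<in> pair_span RR G)}"
  have uvT: "u \<in> carrier T" "v \<in> carrier T" using uv by auto
  \<comment> \<open>The factor \<open>s\<close> is moved onto \<open>c\<close>; the product stays in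
    \<open>C\<close>, which is an ideal of \<open>T\<close>, so the same \<open>G\<close>
    works.\<close>
  have J_mult: "s \<otimes> t \<in> J" if t: "t \<in> J" and s: "s \<in> carrier T" for s t
  proof -
    obtain G where G: "finite G" "G \<subseteq> syzygies RR u v"
      "\<And>c. c \<in> C \<Longrightarrow> ((c \<otimes> t) \<otimes> v, \<ominus> ((c \<otimes> t) \<otimes> u)) \<in> pair_span RR G"
      and tT: "t \<in> carrier T"
      using t by (auto simp: J_def)
    have "((c \<otimes> (s \<otimes> t)) \<otimes> v, \<ominus> ((c \<otimes> (s \<otimes> t)) \<otimes> u)) \<in> pair_span RR G" if "c \<in> C" for c
      using G(3)[of "c \<otimes> s"] C.I_r_closed[OF that s] m_assoc[OF _ s tT, of c] that by simp
    then show ?thesis using G tT s by (auto simp: J_def)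
  qed
  have J_add: "t \<oplus> t' \<in> J" if t: "t \<in> J" and t': "t' \<in> J" for t t'
  proof -
    obtain G where G: "finite G" "G \<subseteq> syzygies RR u v"
      "\<And>c. c \<in> C \<Longrightarrow> ((c \<otimes> t) \<otimes> v, \<ominus> ((c \<otimes> t) \<otimes> u)) \<in> pair_span RR G"
      and tT: "t \<in> carrier T"
      using t by (auto simp: J_def)
    obtain G' where G': "finite G'" "G' \<subseteq> syzygies RR u v"
      "\<And>c. c \<in> C \<Longrightarrow> ((c \<otimes> t') \<otimes> v, \<ominus> ((c \<otimes> t') \<otimes> u)) \<in> pair_span RR G'"
      and t'T: "t' \<in> carrier T"
      using t' by (auto simp: J_def)
    have carr: "G \<union> G' \<subseteq> carrier RR \<times> carrier RR"
      using G(2) G'(2) syzygies_subset[of RR u v] by auto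
    have "((c \<otimes> (t \<oplus> t')) \<otimes> v, \<ominus> ((c \<otimes> (t \<oplus> t')) \<otimes> u)) \<in> pair_span RR (G \<union> G')"
      if c: "c \<in> C" for c
    proof -
      have cT: "c \<in> carrier T" using c by auto
      have "(c \<otimes> (t \<oplus> t')) \<otimes> v = (c \<otimes> t) \<otimes> v \<oplus> (c \<otimes> t') \<otimes> v"
        "\<ominus> ((c \<otimes> (t \<oplus> t')) \<otimes> u) = \<ominus> ((c \<otimes> t) \<otimes> u) \<oplus> \<ominus> ((c \<otimes> t') \<otimes> u)"
        using cT tT t'T uvT by algebra+
      then show ?thesis
        using RR.pair_span_add[OF carr pair_span_mono[OF G(3)[OF c]] pair_span_mono[OF G'(3)[OF c]]]
        by simp
    qed
    then show ?thesis using G(1,2) G'(1,2) tT t'T unfolding J_def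
      by (intro CollectI conjI exI[of _ "G \<union> G'"]) auto
  qed
  have J_zero: "\<zero> \<in> J"
    using uvT by (auto simp: J_def intro!: exI[of _ "{}"] pair_span.zero[of RR, simplified])
  interpret J: ideal J T
  proof (rule idealI[OF ring_axioms])
    show "subgroup J (add_monoid T)"
    proof (rule add.subgroupI)
      show "J \<subseteq> carrier T" by (auto simp: J_def)
      show "J \<noteq> {}" using J_zero by blast
      show "\<ominus> t \<in> J" if "t \<in> J" for t
        using J_mult[OF that, of "\<ominus> \<one>"] that by (simp add: J_def l_minus)
    qed (rule J_add)
    show "t \<otimes> s \<in> J" if "t \<in> J" "s \<in> carrier T" for t s
      using J_mult[OF that] that by (simp add: J_def m_comm)
  qed (rule J_mult)
  let ?Q = "T Quot J" and ?\<pi> = "(+>) J"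
  interpret \<pi>: ring_hom_cring T ?Q ?\<pi> by (rule J.rcos_ring_hom_cring[OF is_cring])
  \<comment> \<open>This is the coefficient from \<open>syzygy_unimodular\<close>: for a syzygy (x,
    y), multiplying (v, -u) by \<open>\<delta> x y\<close> gives (x, y) back.\<close>
  define \<delta> where "\<delta> x y = q \<otimes> x \<ominus> p \<otimes> y" for x y
  have \<delta>_carrier: "\<delta> x y \<in> carrier T" if "x \<in> R" "y \<in> R" for x y
    using that pq by (simp add: \<delta>_def)
  \<comment> \<open>The single pair (x, y) serves as \<open>G\<close>: multiplying (v, -u) by
    \<open>c \<otimes> \<delta> x y\<close> gives c (x, y), and c is a scalar from
    \<open>R\<close>.\<close>
  have \<delta>_syz: "\<delta> x y \<in> J" if xy: "x \<in> R" "y \<in> R" "x \<otimes> u \<oplus> y \<otimes> v = \<zero>" for x y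
  proof -
    have carr: "{(x, y)} \<subseteq> carrier RR \<times> carrier RR" using xy by simp
    note * = syzygy_unimodular[OF uvT pq one R_carrier[OF xy(1)] R_carrier[OF xy(2)] xy(3), folded \<delta>_def]
    have "((c \<otimes> \<delta> x y) \<otimes> v, \<ominus> ((c \<otimes> \<delta> x y) \<otimes> u)) \<in> pair_span RR {(x, y)}" if c: "c \<in> C" for c
    proof -
      have "c \<in> carrier T" using c by auto
      then have "(c \<otimes> \<delta> x y) \<otimes> v = c \<otimes> (\<delta> x y \<otimes> v)"
        "\<ominus> ((c \<otimes> \<delta> x y) \<otimes> u) = c \<otimes> (\<delta> x y \<otimes> (\<ominus> u))"
        using \<delta>_carrier[OF xy(1,2)] uvT by algebra+
      then show ?thesis
        using RR.pair_span_smult_gen[OF carr, of c x y] c * by simp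
    qed
    then show ?thesis
      using xy \<delta>_carrier unfolding J_def
      by (intro CollectI conjI exI[of _ "{(x, y)}"]) (auto simp: mem_syzygies_RR)
  qed
  \<comment> \<open>Two representations x u + y v of the same element differ by a syzygy, so by
    \<open>\<delta>_syz\<close> every choice gives the same value modulo \<open>J\<close>.\<close>
  define \<kappa> where "\<kappa> z = (SOME w. \<exists>x\<in>R. \<exists>y\<in>R. z = x \<otimes> u \<oplus> y \<otimes> v \<and> w = \<delta> x y)" for z
  have \<kappa>: "?\<pi> (\<kappa> (x \<otimes> u \<oplus> y \<otimes> v)) = ?\<pi> (\<delta> x y)" "\<kappa> (x \<otimes> u \<oplus> y \<otimes> v) \<in> carrier T"
    if xy: "x \<in> R" "y \<in> R" for x y
  proof -
    have "\<exists>w. \<exists>x'\<in>R. \<exists>y'\<in>R. x \<otimes> u \<oplus> y \<otimes> v = x' \<otimes> u \<oplus> y' \<otimes> v \<and> w = \<delta> x' y'"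
      using xy by blast
    from someI_ex[OF this, folded \<kappa>_def]
    obtain x' y' where xy': "x' \<in> R" "y' \<in> R" "x \<otimes> u \<oplus> y \<otimes> v = x' \<otimes> u \<oplus> y' \<otimes> v"
      and k: "\<kappa> (x \<otimes> u \<oplus> y \<otimes> v) = \<delta> x' y'" by blast
    have T: "x \<in> carrier T" "y \<in> carrier T" "x' \<in> carrier T" "y' \<in> carrier T"
      using xy xy' by auto
    have "(x' \<ominus> x) \<otimes> u \<oplus> (y' \<ominus> y) \<otimes> v = (x' \<otimes> u \<oplus> y' \<otimes> v) \<ominus> (x \<otimes> u \<oplus> y \<otimes> v)"
      using T uvT by algebra
    then have "\<delta> (x' \<ominus> x) (y' \<ominus> y) \<in> J"
      using xy xy' uvT by (intro \<delta>_syz) (simp_all add: minus_eq r_neg)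
    moreover have "\<delta> x' y' = \<delta> (x' \<ominus> x) (y' \<ominus> y) \<oplus> \<delta> x y"
      unfolding \<delta>_def using T pq by algebra
    ultimately show "?\<pi> (\<kappa> (x \<otimes> u \<oplus> y \<otimes> v)) = ?\<pi> (\<delta> x y)" "\<kappa> (x \<otimes> u \<oplus> y \<otimes> v) \<in> carrier T"
      using k xy xy' \<delta>_carrier[of x y] \<delta>_carrier[of x' y'] \<delta>_carrier[of "x' \<ominus> x" "y' \<ominus> y"]
        J.rcos_zero_iff[of "\<delta> (x' \<ominus> x) (y' \<ominus> y)"] by (simp_all del: FactRing_def)
  qed
  \<comment> \<open>An injection into the element type of the test modules: the singleton of a
    constant sequence.\<close>
  define \<iota> :: "'a \<Rightarrow> (nat \<Rightarrow> 'a) set" where "\<iota> x = {\<lambda>_. x}" for x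
  have \<iota>: "inj \<iota>" by (auto simp: inj_on_def \<iota>_def fun_eq_iff)
  note [simp] = inv_f_f[OF \<iota>]
  define I where "I = Idl\<^bsub>RR\<^esub> {u, v}"
  have I: "ideal I RR" using uv by (auto simp: I_def intro!: RR.genideal_ideal)
  have I_eq: "I = {x \<otimes> u \<oplus> y \<otimes> v | x y. x \<in> R \<and> y \<in> R}"
    using RR.ideal_two_gen[of u v] uv by (simp add: I_def)
  have I_R: "I \<subseteq> R" using uv by (auto simp: I_eq)
  define M' where "M' = module_image \<iota> (ideal_module RR I)"
  \<comment> \<open>\<open>R\<close> enters as an ideal of itself and is transported by the same
    \<open>\<iota>\<close>, so that the inclusion of \<open>I\<close> becomes the identity
    function.\<close>
  define M where "M = module_image \<iota> (ideal_module RR R)"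
  define N where "N = regular_module T"
  have M'_simps: "carrier M' = \<iota> ` I" "\<iota> x \<oplus>\<^bsub>M'\<^esub> \<iota> y = \<iota> (x \<oplus> y)" "a \<odot>\<^bsub>M'\<^esub> \<iota> x = \<iota> (a \<otimes> x)" for a x y
    by (simp_all add: M'_def module_image_simps ideal_module_simps)
  have M_simps: "carrier M = \<iota> ` R" "\<iota> x \<oplus>\<^bsub>M\<^esub> \<iota> y = \<iota> (x \<oplus> y)" "a \<odot>\<^bsub>M\<^esub> \<iota> x = \<iota> (a \<otimes> x)" for a x y
    by (simp_all add: M_def module_image_simps ideal_module_simps)
  have N_simps: "carrier N = carrier T" "x \<oplus>\<^bsub>N\<^esub> y = x \<oplus> y" "a \<odot>\<^bsub>N\<^esub> x = a \<otimes> x" for a x y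
    by (simp_all add: N_def regular_module_def)
  have modN: "module RR N" using flat by (simp add: flat_module_def N_def)
  have modM': "module RR M'"
    unfolding M'_def by (rule module.module_image[OF RR.module_ideal[OF I] \<iota>])
  have modM: "module RR M"
    unfolding M_def
    by (rule module.module_image[OF RR.module_ideal \<iota>]) (use RR.oneideal in simp)
  define g where "g = (\<lambda>(Z, t). ?\<pi> (\<kappa> (inv_into UNIV \<iota> Z)) \<otimes>\<^bsub>?Q\<^esub> ?\<pi> t)"
  have g: "g (\<iota> (x \<otimes> u \<oplus> y \<otimes> v), t) = ?\<pi> (\<delta> x y) \<otimes>\<^bsub>?Q\<^esub> ?\<pi> t" if "x \<in> R" "y \<in> R" for x y t
    using \<kappa>[OF that] by (simp add: g_def)
  have "g ` (carrier M' \<times> carrier N) \<subseteq> carrier (add_monoid ?Q)"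
  proof (rule image_subsetI)
    fix z assume "z \<in> carrier M' \<times> carrier N"
    then show "g z \<in> carrier (add_monoid ?Q)"
      using g \<delta>_carrier by (auto simp: M'_simps I_eq N_simps)
  qed
  then obtain h where h: "h \<in> hom (free_Abelian_group (carrier M' \<times> carrier N)) (add_monoid ?Q)"
    and hg: "\<And>Z t. Z \<in> carrier M' \<Longrightarrow> t \<in> carrier T \<Longrightarrow> h (frag_of (Z, t)) = g (Z, t)"
    using comm_group.free_Abelian_group_universal[OF \<pi>.S.a_comm_group] N_simps(1)
    by (metis mem_Sigma_iff)
  interpret h: group_hom "free_Abelian_group (carrier M' \<times> carrier N)" "add_monoid ?Q" h
    by (intro group_hom.intro group_hom_axioms.intro h \<pi>.S.a_group) simp
  have h_add: "h (w + w') = h w \<oplus>\<^bsub>?Q\<^esub> h w'"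
    if "Poly_Mapping.keys w \<subseteq> carrier M' \<times> carrier N" "Poly_Mapping.keys w' \<subseteq> carrier M' \<times> carrier N" for w w'
    using h.hom_mult[of w w'] that by simp
  have h_minus: "h (- w) = \<ominus>\<^bsub>?Q\<^esub> h w"
    if "Poly_Mapping.keys w \<subseteq> carrier M' \<times> carrier N" for w
    using h.hom_inv[of w] that by (simp add: a_inv_def)
  have h_diff: "h (w - w') = h w \<ominus>\<^bsub>?Q\<^esub> h w'"
    if "Poly_Mapping.keys w \<subseteq> carrier M' \<times> carrier N" "Poly_Mapping.keys w' \<subseteq> carrier M' \<times> carrier N" for w w'
    using h_add[of w "- w'"] h_minus[of w'] that by (simp add: \<pi>.S.minus_eq)
  have hM': "h (frag_of (\<iota> (x \<otimes> u \<oplus> y \<otimes> v), t)) = ?\<pi> (\<delta> x y \<otimes> t)"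
    if "x \<in> R" "y \<in> R" "t \<in> carrier T" for x y t
  proof -
    have "\<iota> (x \<otimes> u \<oplus> y \<otimes> v) \<in> carrier M'" using that by (auto simp: M'_simps I_eq)
    then show ?thesis
      using that hg g[OF that(1,2)] \<delta>_carrier by simp
  qed
  have keys: "Poly_Mapping.keys (frag_of (\<iota> (x \<otimes> u \<oplus> y \<otimes> v), t)) \<subseteq> carrier M' \<times> carrier N"
    if "x \<in> R" "y \<in> R" "t \<in> carrier T" for x y t
    using that by (auto simp: M'_simps I_eq N_simps)
  have Q_cancel: "?\<pi> (s \<oplus> t) \<ominus>\<^bsub>?Q\<^esub> ?\<pi> s \<ominus>\<^bsub>?Q\<^esub> ?\<pi> t = \<zero>\<^bsub>?Q\<^esub>"
    if "s \<in> carrier T" "t \<in> carrier T" for s t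
  proof -
    have "?\<pi> (s \<oplus> t) \<ominus>\<^bsub>?Q\<^esub> ?\<pi> s \<ominus>\<^bsub>?Q\<^esub> ?\<pi> t = ?\<pi> (s \<oplus> t \<ominus> s \<ominus> t)"
      using that by (simp add: minus_eq \<pi>.S.minus_eq)
    moreover have "s \<oplus> t \<ominus> s \<ominus> t = \<zero>" using that by algebra
    ultimately show ?thesis by simp
  qed
  \<comment> \<open>That \<open>h\<close> kills the relations is the well-definedness of the map on
    the tensor product. The argument stays with formal sums and forms no induced map on
    cosets.\<close>
  have kill: "h w = \<zero>\<^bsub>?Q\<^esub>" if "w \<in> tensor_relations RR M' N" for w
    using that modM' modN
  proof (induction rule: tensor_relations_induct)
    case zero
    then show ?case using h.hom_one by simp
  next
    case (uminus w)
    then show ?case by (simp add: h_minus)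
  next
    case (add w w')
    then show ?case by (simp add: h_add)
  next
    case (l_distr Z Z' t)
    then obtain x y x' y' where xy: "x \<in> R" "y \<in> R" "x' \<in> R" "y' \<in> R" and t: "t \<in> carrier T"
      and Z: "Z = \<iota> (x \<otimes> u \<oplus> y \<otimes> v)" "Z' = \<iota> (x' \<otimes> u \<oplus> y' \<otimes> v)"
      by (auto simp: M'_simps I_eq N_simps)
    have T: "x \<in> carrier T" "y \<in> carrier T" "x' \<in> carrier T" "y' \<in> carrier T"
      using xy by auto
    have sum: "Z \<oplus>\<^bsub>M'\<^esub> Z' = \<iota> ((x \<oplus> x') \<otimes> u \<oplus> (y \<oplus> y') \<otimes> v)"
      unfolding Z M'_simps by (rule arg_cong[of _ _ \<iota>]) (use T uvT in algebra)
    have eq: "\<delta> (x \<oplus> x') (y \<oplus> y') \<otimes> t = \<delta> x y \<otimes> t \<oplus> \<delta> x' y' \<otimes> t"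
      unfolding \<delta>_def using T pq t by algebra
    have xy'': "x \<oplus> x' \<in> R" "y \<oplus> y' \<in> R" using xy by auto
    note k = keys[OF xy'' t] keys[OF xy(1,2) t] keys[OF xy(3,4) t]
    have "\<delta> x y \<otimes> t \<in> carrier T" "\<delta> x' y' \<otimes> t \<in> carrier T" using \<delta>_carrier xy t by auto
    then show ?case
      unfolding sum unfolding Z h_diff[OF keys_diff_subset[OF k(1,2)] k(3)] h_diff[OF k(1,2)]
        hM'[OF xy'' t] hM'[OF xy(1,2) t] hM'[OF xy(3,4) t] eq
      by (rule Q_cancel)
  next
    case (r_distr Z t t')
    then obtain x y where xy: "x \<in> R" "y \<in> R" and t: "t \<in> carrier T" "t' \<in> carrier T"
      and Z: "Z = \<iota> (x \<otimes> u \<oplus> y \<otimes> v)"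
      by (auto simp: M'_simps I_eq N_simps)
    have eq: "\<delta> x y \<otimes> (t \<oplus> t') = \<delta> x y \<otimes> t \<oplus> \<delta> x y \<otimes> t'"
      using \<delta>_carrier[OF xy] t by algebra
    have t': "t \<oplus> t' \<in> carrier T" using t by simp
    note k = keys[OF xy t'] keys[OF xy t(1)] keys[OF xy t(2)]
    have "\<delta> x y \<otimes> t \<in> carrier T" "\<delta> x y \<otimes> t' \<in> carrier T" using \<delta>_carrier xy t by auto
    then show ?case
      unfolding Z N_simps h_diff[OF keys_diff_subset[OF k(1,2)] k(3)] h_diff[OF k(1,2)]
        hM'[OF xy t'] hM'[OF xy t(1)] hM'[OF xy t(2)] eq
      by (rule Q_cancel)
  next
    case (balanced a Z t)
    then obtain x y where xy: "x \<in> R" "y \<in> R" and t: "t \<in> carrier T" and a: "a \<in> R"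
      and Z: "Z = \<iota> (x \<otimes> u \<oplus> y \<otimes> v)"
      by (auto simp: M'_simps I_eq N_simps)
    have T: "x \<in> carrier T" "y \<in> carrier T" "a \<in> carrier T"
      using xy a by auto
    have prod: "a \<odot>\<^bsub>M'\<^esub> Z = \<iota> ((a \<otimes> x) \<otimes> u \<oplus> (a \<otimes> y) \<otimes> v)"
      unfolding Z M'_simps by (rule arg_cong[of _ _ \<iota>]) (use T uvT in algebra)
    have eq: "\<delta> (a \<otimes> x) (a \<otimes> y) \<otimes> t = \<delta> x y \<otimes> (a \<otimes> t)"
      unfolding \<delta>_def using T pq t by algebra
    have ax: "a \<otimes> x \<in> R" "a \<otimes> y \<in> R" and at: "a \<otimes> t \<in> carrier T"
      using xy a T t by auto
    note k = keys[OF ax t] keys[OF xy at]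
    have "\<delta> x y \<otimes> (a \<otimes> t) \<in> carrier T" using \<delta>_carrier xy at by auto
    then show ?case
      unfolding prod N_simps unfolding Z h_diff[OF k] hM'[OF ax t] hM'[OF xy at] eq
      by (simp add: \<pi>.S.minus_eq \<pi>.S.r_neg del: \<pi>.hom_mult)
  qed
  let ?\<xi> = "frag_of (\<iota> u, v) - frag_of (\<iota> v, u)"
  have u: "u = \<one> \<otimes> u \<oplus> \<zero> \<otimes> v" and v: "v = \<zero> \<otimes> u \<oplus> \<one> \<otimes> v"
    using uvT by simp_all
  have keys_uv: "Poly_Mapping.keys (frag_of (\<iota> u, v)) \<subseteq> carrier M' \<times> carrier N"
    "Poly_Mapping.keys (frag_of (\<iota> v, u)) \<subseteq> carrier M' \<times> carrier N"
    using keys[of \<one> \<zero> v] keys[of \<zero> \<one> u] u v uvT by (simp_all del: keys_frag_of)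
  have "?\<xi> \<in> tensor_relations RR M' N"
  proof (rule flat_tensor_relations[where f = "\<lambda>x. x", OF _ modM' modM])
    show "flat_module TYPE((nat \<Rightarrow> 'a) set) RR N" using flat by (simp add: N_def)
    show "(\<lambda>x. x) \<in> module_hom RR M' M"
      unfolding module_hom_def using I_R by (auto simp: M'_simps M_simps)
    show "inj_on (\<lambda>x. x) (carrier M')" by simp
    show "Poly_Mapping.keys ?\<xi> \<subseteq> carrier M' \<times> carrier N"
      using keys_uv by (rule keys_diff_subset)
    have sub: "subgroup (tensor_relations RR M N) (free_Abelian_group (carrier M \<times> carrier N))"
      by (rule tensor_relations_subgroup[OF modM modN])
    have \<iota>1: "\<iota> \<one> \<in> carrier M" by (simp add: M_simps)
    \<comment> \<open>In the tensor product of \<open>R\<close> with \<open>T\<close> both terms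
      equal 1 \<otimes> u v, because u and v are scalars from \<open>R\<close> and can be moved to
      the right.\<close>
    have *: "frag_of (\<iota> u, v) - frag_of (\<iota> \<one>, u \<otimes> v) \<in> tensor_relations RR M N"
      "frag_of (\<iota> v, u) - frag_of (\<iota> \<one>, u \<otimes> v) \<in> tensor_relations RR M N"
      using tensor_relations_intros(3)[of u RR "\<iota> \<one>" M v N] tensor_relations_intros(3)[of v RR "\<iota> \<one>" M u N]
        \<iota>1 uv uvT by (simp_all add: M_simps N_simps m_comm[of v u])
    have "- (frag_of (\<iota> v, u) - frag_of (\<iota> \<one>, u \<otimes> v)) \<in> tensor_relations RR M N"
      using subgroup.m_inv_closed[OF sub *(2)] subgroup.mem_carrier[OF sub *(2)] by simp
    from subgroup.m_closed[OF sub *(1) this]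
    show "frag_extend (\<lambda>(x, y). frag_of (x, y)) ?\<xi> \<in> tensor_relations RR M N"
      by (simp add: frag_extend_diff)
  qed
  then have "h ?\<xi> = \<zero>\<^bsub>?Q\<^esub>" by (rule kill)
  moreover have "h ?\<xi> = ?\<pi> (\<delta> \<one> \<zero> \<otimes> v) \<ominus>\<^bsub>?Q\<^esub> ?\<pi> (\<delta> \<zero> \<one> \<otimes> u)"
    unfolding h_diff[OF keys_uv]
    using hM'[of \<one> \<zero> v] hM'[of \<zero> \<one> u] uvT by (simp del: \<pi>.hom_mult)
  moreover have "\<dots> = ?\<pi> (\<delta> \<one> \<zero> \<otimes> v \<ominus> \<delta> \<zero> \<one> \<otimes> u)"
    using \<delta>_carrier uvT by (simp add: minus_eq \<pi>.S.minus_eq)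
  \<comment> \<open>Here \<open>\<delta> \<one> \<zero>\<close> is q and
    \<open>\<delta> \<zero> \<one>\<close> is -p.\<close>
  moreover have "\<delta> \<one> \<zero> \<otimes> v \<ominus> \<delta> \<zero> \<one> \<otimes> u = p \<otimes> u \<oplus> q \<otimes> v"
    unfolding \<delta>_def using uvT pq by algebra
  ultimately have "?\<pi> \<one> = \<zero>\<^bsub>?Q\<^esub>" using one by metis
  then have "\<one> \<in> J" using J.rcos_zero_iff[OF one_closed] by blast
  then have "\<exists>G. finite G \<and> G \<subseteq> syzygies RR u v \<and>
    (\<forall>c\<in>C. ((c \<otimes> \<one>) \<otimes> v, \<ominus> ((c \<otimes> \<one>) \<otimes> u)) \<in> pair_span RR G)"
    unfolding J_def mem_Collect_eq by (rule conjunct2)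
  then obtain G where G: "finite G" "G \<subseteq> syzygies RR u v"
    "\<And>c. c \<in> C \<Longrightarrow> ((c \<otimes> \<one>) \<otimes> v, \<ominus> ((c \<otimes> \<one>) \<otimes> u)) \<in> pair_span RR G"
    by metis
  show ?thesis
  proof (rule that[OF G(1,2)])
    fix c assume c: "c \<in> C"
    then have "c \<otimes> \<one> = c" by (simp add: R_carrier[OF C_R])
    with G(3)[OF c] show "(c \<otimes> v, \<ominus> (c \<otimes> u)) \<in> pair_span RR G" by simp
  qed
qed

end

section \<open>Syzygies over \<open>R\<close> and over its quotient by the conductor\<close>

context conductor_ideal
begin

abbreviation "A \<equiv> RR Quot C"
abbreviation "\<pi> \<equiv> a_r_coset RR C"

sublocale \<pi>: ring_hom_cring RR A \<pi>
  by (rule CR.rcos_ring_hom_cring[OF RR.is_cring])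

lemma \<pi>_zero_iff: "x \<in> R \<Longrightarrow> \<pi> x = \<zero>\<^bsub>A\<^esub> \<longleftrightarrow> x \<in> C"
  using CR.rcos_zero_iff by simp

lemma \<pi>_hom: "x \<in> R \<Longrightarrow> \<pi> x \<in> carrier A"
  "x \<in> R \<Longrightarrow> y \<in> R \<Longrightarrow> \<pi> (x \<oplus> y) = \<pi> x \<oplus>\<^bsub>A\<^esub> \<pi> y"
  "x \<in> R \<Longrightarrow> y \<in> R \<Longrightarrow> \<pi> (x \<otimes> y) = \<pi> x \<otimes>\<^bsub>A\<^esub> \<pi> y"
  using \<pi>.hom_closed[of x] \<pi>.hom_add[of x y] \<pi>.hom_mult[of x y] by simp_all

lemma \<pi>_surj:
  assumes "z \<in> carrier A"
  obtains x where "x \<in> R" "\<pi> x = z"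
  using assms by (auto simp: FactRing_def A_RCOSETS_def')

lemma \<pi>_eq_iff:
  assumes "x \<in> R" "y \<in> R"
  shows "\<pi> x = \<pi> y \<longleftrightarrow> x \<ominus> y \<in> C"
proof -
  have "x = (x \<ominus> y) \<oplus> y" using assms[THEN R_carrier] by algebra
  then have "\<pi> x = \<pi> (x \<ominus> y) \<oplus>\<^bsub>A\<^esub> \<pi> y"
    using assms \<pi>_hom(2)[of "x \<ominus> y" y] by simp
  then have "\<pi> x = \<pi> y \<longleftrightarrow> \<pi> (x \<ominus> y) = \<zero>\<^bsub>A\<^esub>"
    using assms \<pi>_hom(1) by (simp add: \<pi>.S.add.l_cancel_one)
  then show ?thesis using assms \<pi>_zero_iff by simp
qed

text \<open>Although p and q are only in \<open>T\<close>, the products c p and c q lie in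
  \<open>C\<close>, an ideal of \<open>T\<close> contained in \<open>R\<close>. The defect c = (c p)
  u + (c q) v of arbitrary lifts can thus be removed without changing their classes modulo
  \<open>C\<close>.\<close>

lemma lift_syzygy:
  assumes uv: "u \<in> R" "v \<in> R" and pq: "p \<in> carrier T" "q \<in> carrier T"
    and one: "p \<otimes> u \<oplus> q \<otimes> v = \<one>"
    and xy': "(x', y') \<in> syzygies A (\<pi> u) (\<pi> v)"
  shows "\<exists>x y. (x, y) \<in> syzygies RR u v \<and> \<pi> x = x' \<and> \<pi> y = y'"
proof -
  have xyA: "x' \<in> carrier A" "y' \<in> carrier A" "x' \<otimes>\<^bsub>A\<^esub> \<pi> u \<oplus>\<^bsub>A\<^esub> y' \<otimes>\<^bsub>A\<^esub> \<pi> v = \<zero>\<^bsub>A\<^esub>"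
    using xy' by (simp_all add: mem_syzygies)
  obtain x where x: "x \<in> R" "\<pi> x = x'" using \<pi>_surj[OF xyA(1)] .
  obtain y where y: "y \<in> R" "\<pi> y = y'" using \<pi>_surj[OF xyA(2)] .
  define c where "c = x \<otimes> u \<oplus> y \<otimes> v"
  have "\<pi> c = \<zero>\<^bsub>A\<^esub>"
    using xyA(3) x y uv by (simp add: c_def \<pi>_hom)
  then have c: "c \<in> C"
    using \<pi>_zero_iff[of c] x y uv by (simp add: c_def)
  then have cpq: "c \<otimes> p \<in> C" "c \<otimes> q \<in> C"
    using pq by (auto intro: C.I_r_closed)
  have T: "x \<in> carrier T" "y \<in> carrier T" "u \<in> carrier T" "v \<in> carrier T" "c \<in> carrier T"
    using x y uv c by auto
  have "(x \<ominus> c \<otimes> p) \<otimes> u \<oplus> (y \<ominus> c \<otimes> q) \<otimes> v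
      = (x \<otimes> u \<oplus> y \<otimes> v) \<ominus> c \<otimes> (p \<otimes> u \<oplus> q \<otimes> v)"
    using T pq by algebra
  then have "(x \<ominus> c \<otimes> p, y \<ominus> c \<otimes> q) \<in> syzygies RR u v"
    using one x y cpq T by (simp add: mem_syzygies_RR c_def[symmetric] minus_eq r_neg)
  moreover have "\<pi> (x \<ominus> c \<otimes> p) = \<pi> x" "\<pi> (y \<ominus> c \<otimes> q) = \<pi> y"
  proof -
    have "(x \<ominus> c \<otimes> p) \<ominus> x = (\<ominus> \<one>) \<otimes> (c \<otimes> p)" "(y \<ominus> c \<otimes> q) \<ominus> y = (\<ominus> \<one>) \<otimes> (c \<otimes> q)"
      using T pq by algebra+
    then have "(x \<ominus> c \<otimes> p) \<ominus> x \<in> C" "(y \<ominus> c \<otimes> q) \<ominus> y \<in> C"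
      using C.I_l_closed[OF cpq(1), of "\<ominus> \<one>"] C.I_l_closed[OF cpq(2), of "\<ominus> \<one>"] by simp_all
    then show "\<pi> (x \<ominus> c \<otimes> p) = \<pi> x" "\<pi> (y \<ominus> c \<otimes> q) = \<pi> y"
      using \<pi>_eq_iff[of "x \<ominus> c \<otimes> p" x] \<pi>_eq_iff[of "y \<ominus> c \<otimes> q" y]
        R_minus[OF x(1) C_R[OF cpq(1)]] R_minus[OF y(1) C_R[OF cpq(2)]] x(1) y(1) by blast+
  qed
  ultimately show ?thesis using x y by metis
qed

lemma syzygies_fg_quotient:
  assumes "u \<in> R" "v \<in> R" "p \<in> carrier T" "q \<in> carrier T" "p \<otimes> u \<oplus> q \<otimes> v = \<one>"
    and "syzygies_fg RR u v"
  shows "syzygies_fg A (\<pi> u) (\<pi> v)"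
  by (rule syzygies_fg_image[OF \<pi>.ring_hom_cring_axioms])
    (use assms lift_syzygy[OF assms(1-5)] in auto)

text \<open>Lifts of generators over \<open>A\<close> produce each syzygy up to one with entries in
  \<open>C\<close>. The set \<open>G'\<close> supplied by flatness generates those remaining
  ones.\<close>

lemma syzygies_fg_lift:
  assumes flat: "flat_module TYPE((nat \<Rightarrow> 'a) set) RR (regular_module T)"
    and uv: "u \<in> R" "v \<in> R" and pq: "p \<in> carrier T" "q \<in> carrier T"
    and one: "p \<otimes> u \<oplus> q \<otimes> v = \<one>"
    and fg: "syzygies_fg A (\<pi> u) (\<pi> v)"
  shows "syzygies_fg RR u v"
proof -
  obtain G where G: "finite G" "G \<subseteq> syzygies A (\<pi> u) (\<pi> v)" "syzygies A (\<pi> u) (\<pi> v) \<subseteq> pair_span A G"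
    using fg by (auto simp: syzygies_fg_def)
  have "\<forall>z\<in>G. \<exists>w. w \<in> syzygies RR u v \<and> map_prod \<pi> \<pi> w = z"
  proof
    fix z assume "z \<in> G"
    then have "(fst z, snd z) \<in> syzygies A (\<pi> u) (\<pi> v)" using G(2) by auto
    from lift_syzygy[OF uv pq one this]
    obtain x y where "(x, y) \<in> syzygies RR u v" "\<pi> x = fst z" "\<pi> y = snd z" by blast
    then show "\<exists>w. w \<in> syzygies RR u v \<and> map_prod \<pi> \<pi> w = z"
      by (intro exI[of _ "(x, y)"]) simp
  qed
  from bchoice[OF this]
  obtain lft where lft: "\<And>z. z \<in> G \<Longrightarrow> lft z \<in> syzygies RR u v" "\<And>z. z \<in> G \<Longrightarrow> map_prod \<pi> \<pi> (lft z) = z"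
    by metis
  obtain G' where G': "finite G'" "G' \<subseteq> syzygies RR u v"
    "\<And>c. c \<in> C \<Longrightarrow> (c \<otimes> v, \<ominus> (c \<otimes> u)) \<in> pair_span RR G'"
    using flat_syzygies[OF flat uv pq one] by metis
  let ?G = "lft ` G \<union> G'"
  have syz: "?G \<subseteq> syzygies RR u v" using lft(1) G'(2) by auto
  have carr: "?G \<subseteq> carrier RR \<times> carrier RR"
    using syz syzygies_subset by (rule subset_trans)
  have uvT: "u \<in> carrier T" "v \<in> carrier T" using uv by auto
  \<comment> \<open>A linear combination over \<open>A\<close> is lifted term by term, since its
    coefficients lift along the surjection \<open>\<pi>\<close>.\<close>
  have lift: "\<exists>x y. (x, y) \<in> pair_span RR ?G \<and> \<pi> x = x' \<and> \<pi> y = y'"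
    if "(x', y') \<in> pair_span A G" for x' y'
    using that
  proof (induction rule: pair_span.induct)
    case zero
    then show ?case using pair_span.zero[of RR ?G] \<pi>.hom_zero by blast
  next
    case (step x' y' g' h' c')
    from step.IH obtain x y where xy: "(x, y) \<in> pair_span RR ?G" "\<pi> x = x'" "\<pi> y = y'" by blast
    obtain g h where gh: "lft (g', h') = (g, h)" by (cases "lft (g', h')")
    then have ghG: "(g, h) \<in> ?G" and gh': "\<pi> g = g'" "\<pi> h = h'"
      using step.hyps(2) lft(2)[OF step.hyps(2)] by (auto simp: image_iff) metis
    obtain c where c: "c \<in> R" "\<pi> c = c'" using \<pi>_surj[OF step.hyps(3)] .
    have "g \<in> R" "h \<in> R" using ghG carr by auto
    moreover have "x \<in> R" "y \<in> R" using RR.pair_span_closed[OF xy(1) carr] by auto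
    ultimately have "\<pi> (x \<oplus> c \<otimes> g) = x' \<oplus>\<^bsub>A\<^esub> c' \<otimes>\<^bsub>A\<^esub> g'" "\<pi> (y \<oplus> c \<otimes> h) = y' \<oplus>\<^bsub>A\<^esub> c' \<otimes>\<^bsub>A\<^esub> h'"
      using c gh' xy by (simp_all add: \<pi>_hom)
    moreover have "(x \<oplus> c \<otimes> g, y \<oplus> c \<otimes> h) \<in> pair_span RR ?G"
      using pair_span.step[OF xy(1) ghG, of c] c by simp
    ultimately show ?case by blast
  qed
  have "(x, y) \<in> pair_span RR ?G" if xy: "(x, y) \<in> syzygies RR u v" for x y
  proof -
    have xyR: "x \<in> R" "y \<in> R" and xy0: "x \<otimes> u \<oplus> y \<otimes> v = \<zero>" using xy by (auto simp: mem_syzygies_RR)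
    have "\<pi> x \<otimes>\<^bsub>A\<^esub> \<pi> u \<oplus>\<^bsub>A\<^esub> \<pi> y \<otimes>\<^bsub>A\<^esub> \<pi> v = \<pi> (x \<otimes> u \<oplus> y \<otimes> v)"
      using xyR uv by (simp add: \<pi>_hom)
    also have "\<dots> = \<zero>\<^bsub>A\<^esub>" using xy0 \<pi>.hom_zero by simp
    finally have "(\<pi> x, \<pi> y) \<in> syzygies A (\<pi> u) (\<pi> v)"
      using xyR by (simp add: mem_syzygies \<pi>_hom)
    then have "(\<pi> x, \<pi> y) \<in> pair_span A G" using G(3) by blast
    from lift[OF this] obtain x1 y1 where xy1: "(x1, y1) \<in> pair_span RR ?G" "\<pi> x1 = \<pi> x" "\<pi> y1 = \<pi> y"
      by blast
    have "(x1, y1) \<in> syzygies RR u v"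
      using RR.pair_span_syzygies[OF _ _ syz xy1(1)] uv by simp
    then have xy1R: "x1 \<in> R" "y1 \<in> R" and xy10: "x1 \<otimes> u \<oplus> y1 \<otimes> v = \<zero>" by (auto simp: mem_syzygies_RR)
    have T: "x \<in> carrier T" "y \<in> carrier T" "x1 \<in> carrier T" "y1 \<in> carrier T"
      using xyR xy1R by auto
    define x2 y2 where "x2 = x \<ominus> x1" and "y2 = y \<ominus> y1"
    have C2: "x2 \<in> C" "y2 \<in> C"
      using xy1 \<pi>_eq_iff[OF xyR(1) xy1R(1)] \<pi>_eq_iff[OF xyR(2) xy1R(2)] by (simp_all add: x2_def y2_def)
    then have T2: "x2 \<in> carrier T" "y2 \<in> carrier T" by auto
    have "x2 \<otimes> u \<oplus> y2 \<otimes> v = (x \<otimes> u \<oplus> y \<otimes> v) \<ominus> (x1 \<otimes> u \<oplus> y1 \<otimes> v)"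
      unfolding x2_def y2_def using T uvT by algebra
    then have "x2 \<otimes> u \<oplus> y2 \<otimes> v = \<zero>" using xy0 xy10 by (simp add: minus_eq)
    note * = syzygy_unimodular[OF uvT pq one T2 this]
    define t where "t = q \<otimes> x2 \<ominus> p \<otimes> y2"
    \<comment> \<open>The coefficient of (v, -u) is a \<open>T\<close>-combination of x2 and y2,
      which lie in the ideal \<open>C\<close> of \<open>T\<close>. This is what makes
      \<open>G'\<close> applicable.\<close>
    have "t \<in> C"
      unfolding t_def minus_eq using C2 pq by (intro C.a_closed C.a_inv_closed C.I_l_closed)
    then have tT: "t \<in> carrier T" by auto
    have "(t \<otimes> v, \<ominus> (t \<otimes> u)) = (x2, y2)"
      using * tT uvT by (simp add: t_def[symmetric] r_minus)
    then have "(x2, y2) \<in> pair_span RR G'" using G'(3)[OF \<open>t \<in> C\<close>] by simp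
    then have "(x2, y2) \<in> pair_span RR ?G" by (rule pair_span_mono) simp
    from RR.pair_span_add[OF carr this xy1(1)]
    have "(x2 \<oplus> x1, y2 \<oplus> y1) \<in> pair_span RR ?G" by simp
    moreover have "x2 \<oplus> x1 = x" "y2 \<oplus> y1 = y"
      unfolding x2_def y2_def using T by algebra+
    ultimately show ?thesis by simp
  qed
  then have "syzygies RR u v \<subseteq> pair_span RR ?G" by auto
  moreover have "finite ?G" using G(1) G'(1) by simp
  ultimately show ?thesis using syz unfolding syzygies_fg_def by blast
qed

lemma unit_cancel:
  assumes "r' \<in> carrier T" "r \<in> carrier T" "z \<in> carrier T" "r' \<otimes> r = \<one>" "r \<otimes> z = \<zero>"
  shows "z = \<zero>"
  using assms by (metis l_one m_assoc r_null)

text \<open>The elements u and v are the members of \<open>U\<close> that correspond to a and b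
  under r I = s U. Injectivity of \<open>s\<close> on \<open>U\<close> shows that they generate
  \<open>U\<close>, so they generate the unit ideal of \<open>T\<close>. It follows that
  \<open>C\<close> lies in \<open>U\<close>, and a non-zero-divisor in \<open>C\<close> extends the
  injectivity of \<open>s\<close> from \<open>U\<close> to \<open>T\<close>.\<close>

lemma unimodular_multiple:
  assumes c: "c \<in> C" "non_zero_divisor c T"
    and ab: "a \<in> R" "b \<in> R" and r: "r \<in> R" "PIdl r = carrier T" and s: "s \<in> R"
    and U: "ideal U RR" "Idl U = carrier T"
    and eq: "ring_multiple T r (Idl\<^bsub>RR\<^esub> {a, b}) = ring_multiple T s U"
    and inj: "inj_on (\<lambda>x. s \<otimes> x) U"
  obtains r' u v p q where "r' \<in> carrier T" "r' \<otimes> r = \<one>" "u \<in> R" "v \<in> R"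
    "p \<in> carrier T" "q \<in> carrier T" "p \<otimes> u \<oplus> q \<otimes> v = \<one>"
    "r \<otimes> a = s \<otimes> u" "r \<otimes> b = s \<otimes> v" "non_zero_divisor s T"
proof -
  interpret U: ideal U RR by fact
  have "\<one> \<in> PIdl r" using r by simp
  then obtain r' where r': "r' \<in> carrier T" "r' \<otimes> r = \<one>" by (auto simp: cgenideal_def)
  have "a \<in> Idl\<^bsub>RR\<^esub> {a, b}" "b \<in> Idl\<^bsub>RR\<^esub> {a, b}"
    using RR.genideal_self[of "{a, b}"] ab by auto
  then have "r \<otimes> a \<in> ring_multiple T s U" "r \<otimes> b \<in> ring_multiple T s U"
    unfolding eq[symmetric] by (auto simp: ring_multiple_def)
  then obtain u v where uv: "u \<in> U" "v \<in> U" "r \<otimes> a = s \<otimes> u" "r \<otimes> b = s \<otimes> v"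
    by (auto simp: ring_multiple_def)
  have uvR: "u \<in> R" "v \<in> R" using uv U.Icarr by auto
  have T: "a \<in> carrier T" "b \<in> carrier T" "u \<in> carrier T" "v \<in> carrier T" "r \<in> carrier T" "s \<in> carrier T"
    using ab uvR r s by auto
  have U_closed: "x \<otimes> u \<oplus> y \<otimes> v \<in> U" if "x \<in> R" "y \<in> R" for x y
    using U.a_closed[OF U.I_l_closed[OF uv(1), of x] U.I_l_closed[OF uv(2), of y]] that by simp
  \<comment> \<open>The multiple s z lies in r I and equals s times a combination of u and v. That
    combination is in \<open>U\<close> too, so \<open>s\<close> cancels.\<close>
  have U_eq: "\<exists>x y. x \<in> R \<and> y \<in> R \<and> z = x \<otimes> u \<oplus> y \<otimes> v" if z: "z \<in> U" for z
  proof -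
    have "s \<otimes> z \<in> ring_multiple T r (Idl\<^bsub>RR\<^esub> {a, b})"
      unfolding eq using z by (auto simp: ring_multiple_def)
    then obtain x y where xy: "x \<in> R" "y \<in> R" "s \<otimes> z = r \<otimes> (x \<otimes> a \<oplus> y \<otimes> b)"
      using RR.ideal_two_gen[of a b] ab by (auto simp: ring_multiple_def)
    have xyT: "x \<in> carrier T" "y \<in> carrier T" using xy by auto
    have "r \<otimes> (x \<otimes> a \<oplus> y \<otimes> b) = x \<otimes> (r \<otimes> a) \<oplus> y \<otimes> (r \<otimes> b)"
      using T xyT by algebra
    also have "\<dots> = s \<otimes> (x \<otimes> u \<oplus> y \<otimes> v)"
      unfolding uv(3,4) using T xyT by algebra
    finally have "s \<otimes> z = s \<otimes> (x \<otimes> u \<oplus> y \<otimes> v)" using xy(3) by simp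
    then have "z = x \<otimes> u \<oplus> y \<otimes> v"
      using inj_onD[OF inj _ z U_closed[OF xy(1,2)]] by simp
    then show ?thesis using xy by blast
  qed
  have "U \<subseteq> Idl {u, v}"
    unfolding ideal_two_gen[OF T(3,4)] using U_eq by blast
  then have "Idl U \<subseteq> Idl {u, v}"
    using genideal_minimal[OF genideal_ideal[of "{u, v}"]] T by simp
  then have "\<one> \<in> Idl {u, v}" unfolding U(2) by blast
  then obtain p q where pq: "p \<in> carrier T" "q \<in> carrier T" "\<one> = p \<otimes> u \<oplus> q \<otimes> v"
    unfolding ideal_two_gen[OF T(3,4)] by blast
  \<comment> \<open>Expanding z = z 1 gives the coefficients z p and z q, which lie in
    \<open>C\<close> and hence in \<open>R\<close>.\<close>
  have CU: "z \<in> U" if z: "z \<in> C" for z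
  proof -
    have zT: "z \<in> carrier T" using z by auto
    have "z = z \<otimes> (p \<otimes> u \<oplus> q \<otimes> v)" using pq(3)[symmetric] zT by simp
    also have "\<dots> = (z \<otimes> p) \<otimes> u \<oplus> (z \<otimes> q) \<otimes> v" using zT T pq(1,2) by algebra
    finally show ?thesis
      using U_closed[of "z \<otimes> p" "z \<otimes> q"] C.I_r_closed[OF z] pq by simp
  qed
  \<comment> \<open>Multiplication by c moves t into \<open>C\<close> and so into \<open>U\<close>,
    where \<open>s\<close> is injective; c is cancelled afterwards.\<close>
  have "t = \<zero>" if t: "t \<in> carrier T" "s \<otimes> t = \<zero>" for t
  proof -
    have cT: "c \<in> carrier T" using c by auto
    have ct: "c \<otimes> t \<in> U" using CU C.I_r_closed[OF c(1) t(1)] .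
    have "\<zero> \<in> U" using CU C.zero_closed .
    moreover have "s \<otimes> (c \<otimes> t) = s \<otimes> \<zero>"
      using t T cT by (metis m_lcomm r_null)
    ultimately have "c \<otimes> t = \<zero>" using inj_onD[OF inj _ ct] by simp
    then show "t = \<zero>" using c t by (simp add: non_zero_divisor_def)
  qed
  then have "non_zero_divisor s T" using T by (simp add: non_zero_divisor_def)
  then show ?thesis using that r' uvR pq uv by metis
qed

end

section \<open>Comparison of \<open>R\<close>, \<open>A\<close> and \<open>T\<close> through
  unimodular pairs\<close>

theorem theorem4p9:
  fixes T :: "'a ring" and R C :: "'a set"
    and \<Lambda> :: "'l set" and D :: "'l \<Rightarrow> 'd ring"
  assumes square: "regular_conductor_square R T C"
    and flat: "flat_module TYPE((nat \<Rightarrow> 'a) set) (subring_of T R) (regular_module T)"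
    and principal: "principalideal C T"
    and ideals: "\<And>I. two_generated_ideal I (subring_of T R) \<Longrightarrow> I \<noteq> {\<zero>\<^bsub>T\<^esub>} \<Longrightarrow>
      \<exists>r\<in>R. \<exists>s\<in>R. \<exists>U. ideal U (subring_of T R) \<and>
        Idl\<^bsub>T\<^esub> U = carrier T \<and> PIdl\<^bsub>T\<^esub> r = carrier T \<and>
        ring_multiple T r I = ring_multiple T s U \<and>
        (\<lambda>x. r \<otimes>\<^bsub>T\<^esub> x) \<in> module_iso (subring_of T R)
          (ideal_module (subring_of T R) I)
          (ideal_module (subring_of T R) (ring_multiple T r I)) \<and>
        (\<lambda>x. s \<otimes>\<^bsub>T\<^esub> x) \<in> module_iso (subring_of T R)
          (ideal_module (subring_of T R) U)
          (ideal_module (subring_of T R) (ring_multiple T s U))"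
    and domains: "\<And>i. i \<in> \<Lambda> \<Longrightarrow> domain (D i)"
    and product: "(subring_of T R) Quot C \<simeq> product_ring \<Lambda> D"
  shows "(finite_conductor_ring (subring_of T R) \<longleftrightarrow>
            finite_conductor_ring ((subring_of T R) Quot C)) \<and>
    (finite_conductor_ring (subring_of T R) \<longrightarrow>
       finite_conductor_ring T \<and> (\<forall>i\<in>\<Lambda>. finite_conductor_ring (D i))) \<and>
    (finite_conductor_ring ((subring_of T R) Quot C) \<longrightarrow>
       finite_conductor_ring T \<and> (\<forall>i\<in>\<Lambda>. finite_conductor_ring (D i)))"
proof -
  obtain c where sq: "conductor_square R T C" and c: "c \<in> C" "non_zero_divisor c T"
    using square by (auto simp: regular_conductor_square_def)
  then interpret conductor_ideal T R C
    by (intro conductor_ideal.intro conductor_ideal_axioms.intro) (auto simp: conductor_square_def)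
  have cT: "c \<in> carrier T" using c by auto
  have c0: "z = \<zero>\<^bsub>T\<^esub>" if "z \<in> carrier T" "c \<otimes>\<^bsub>T\<^esub> z = \<zero>\<^bsub>T\<^esub>" for z
    using c(2) that by (simp add: non_zero_divisor_def)
  obtain f where f: "f \<in> ring_iso A (product_ring \<Lambda> D)"
    using product by (auto simp: is_ring_iso_def)
  interpret prod: product_decomposition A \<Lambda> D f
    by (intro product_decomposition.intro product_decomposition_axioms.intro \<pi>.S.is_cring domains f)
  \<comment> \<open>The condition on ideals, applied to the ideal (a, b) of \<open>R\<close> and
    unpacked into elements.\<close>
  have reduce: "\<exists>r r' s u v p q. r \<in> R \<and> r' \<in> carrier T \<and> r' \<otimes>\<^bsub>T\<^esub> r = \<one>\<^bsub>T\<^esub> \<and> s \<in> R \<and>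
      u \<in> R \<and> v \<in> R \<and> p \<in> carrier T \<and> q \<in> carrier T \<and>
      p \<otimes>\<^bsub>T\<^esub> u \<oplus>\<^bsub>T\<^esub> q \<otimes>\<^bsub>T\<^esub> v = \<one>\<^bsub>T\<^esub> \<and> r \<otimes>\<^bsub>T\<^esub> a = s \<otimes>\<^bsub>T\<^esub> u \<and> r \<otimes>\<^bsub>T\<^esub> b = s \<otimes>\<^bsub>T\<^esub> v \<and>
      non_zero_divisor s T"
    if ab: "a \<in> R" "b \<in> R" and nz: "a \<noteq> \<zero>\<^bsub>T\<^esub> \<or> b \<noteq> \<zero>\<^bsub>T\<^esub>" for a b
  proof -
    let ?I = "Idl\<^bsub>RR\<^esub> {a, b}"
    have two: "two_generated_ideal ?I RR"
      using ab unfolding two_generated_ideal_def by auto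
    have "a \<in> ?I" "b \<in> ?I"
      using RR.genideal_self[of "{a, b}"] ab by auto
    then have "?I \<noteq> {\<zero>\<^bsub>T\<^esub>}" using nz by blast
    from ideals[OF two this]
    obtain r s U where *: "r \<in> R" "s \<in> R" "ideal U RR" "Idl\<^bsub>T\<^esub> U = carrier T"
      "PIdl\<^bsub>T\<^esub> r = carrier T" "ring_multiple T r ?I = ring_multiple T s U"
      and iso: "(\<lambda>x. s \<otimes>\<^bsub>T\<^esub> x) \<in> module_iso RR (ideal_module RR U) (ideal_module RR (ring_multiple T s U))"
      by blast
    have "inj_on (\<lambda>x. s \<otimes>\<^bsub>T\<^esub> x) U"
      using iso by (simp add: module_iso_def bij_betw_def ideal_module_simps)
    from unimodular_multiple[OF c ab *(1,5,2,3,4,6) this]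
    show ?thesis using *(1,2) by metis
  qed
  \<comment> \<open>Over \<open>R\<close> both r and s can be cancelled, since r is a unit and s a
    non-zero-divisor of \<open>T\<close>. So the pair and its unimodular replacement have the same
    syzygies.\<close>
  have syz_RR: "syzygies RR a b = syzygies RR u v"
    if k: "r \<in> R" "r' \<in> carrier T" "r' \<otimes>\<^bsub>T\<^esub> r = \<one>\<^bsub>T\<^esub>" "s \<in> R" and s: "non_zero_divisor s T"
      and R: "a \<in> R" "b \<in> R" "u \<in> R" "v \<in> R" and eq: "r \<otimes>\<^bsub>T\<^esub> a = s \<otimes>\<^bsub>T\<^esub> u" "r \<otimes>\<^bsub>T\<^esub> b = s \<otimes>\<^bsub>T\<^esub> v"
    for r r' s a b u v
  proof -
    have ann: "r \<otimes>\<^bsub>T\<^esub> z = \<zero>\<^bsub>T\<^esub> \<longleftrightarrow> z = \<zero>\<^bsub>T\<^esub>" if z: "z \<in> R" for z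
      using unit_cancel[OF k(2) R_carrier[OF k(1)] R_carrier[OF z] k(3)] k(1) by auto
    have "syzygies RR a b = {(x, y) \<in> carrier RR \<times> carrier RR.
        s \<otimes>\<^bsub>RR\<^esub> (x \<otimes>\<^bsub>RR\<^esub> u \<oplus>\<^bsub>RR\<^esub> y \<otimes>\<^bsub>RR\<^esub> v) = \<zero>\<^bsub>RR\<^esub>}"
      by (rule RR.syzygies_cancel[of r]) (use k(1,4) R eq ann in simp_all)
    also have "\<dots> = syzygies RR u v"
      using s k(4) R by (auto simp: syzygies_def non_zero_divisor_def)
    finally show ?thesis .
  qed
  have A_R: "finite_conductor_ring RR" if fc: "finite_conductor_ring A"
  proof -
    have "syzygies_fg RR a b" if ab: "a \<in> R" "b \<in> R" for a b
    proof (cases "a = \<zero>\<^bsub>T\<^esub> \<and> b = \<zero>\<^bsub>T\<^esub>")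
      case True
      then show ?thesis using RR.syzygies_fg_zero by simp
    next
      case False
      with reduce[OF ab] obtain r r' s u v p q
        where k: "r \<in> R" "r' \<in> carrier T" "r' \<otimes>\<^bsub>T\<^esub> r = \<one>\<^bsub>T\<^esub>" "s \<in> R"
          and uv: "u \<in> R" "v \<in> R" "p \<in> carrier T" "q \<in> carrier T"
          "p \<otimes>\<^bsub>T\<^esub> u \<oplus>\<^bsub>T\<^esub> q \<otimes>\<^bsub>T\<^esub> v = \<one>\<^bsub>T\<^esub>"
          and eq: "r \<otimes>\<^bsub>T\<^esub> a = s \<otimes>\<^bsub>T\<^esub> u" "r \<otimes>\<^bsub>T\<^esub> b = s \<otimes>\<^bsub>T\<^esub> v" and s: "non_zero_divisor s T"
        by blast
      have "syzygies_fg A (\<pi> u) (\<pi> v)"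
        using fc uv \<pi>_hom(1) by (simp add: finite_conductor_ring_iff)
      then have "syzygies_fg RR u v"
        by (rule syzygies_fg_lift[OF flat uv])
      then show ?thesis
        using syz_RR[OF k s ab uv(1,2) eq] by (simp add: syzygies_fg_def)
    qed
    then show ?thesis by (simp add: finite_conductor_ring_iff RR.is_cring)
  qed
  have R_A: "finite_conductor_ring A" if fc: "finite_conductor_ring RR"
  proof -
    have "syzygies_fg A a' b'" if a': "a' \<in> carrier A" and b': "b' \<in> carrier A" for a' b'
    proof -
      obtain a where a: "a \<in> R" "\<pi> a = a'" using \<pi>_surj[OF a'] .
      obtain b where b: "b \<in> R" "\<pi> b = b'" using \<pi>_surj[OF b'] .
      show ?thesis
      \<comment> \<open>The split concerns the lifts to \<open>R\<close>, since the condition on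
        ideals is applied to them; a zero pair over \<open>A\<close> may have non-zero
        lifts.\<close>
      proof (cases "a = \<zero>\<^bsub>T\<^esub> \<and> b = \<zero>\<^bsub>T\<^esub>")
        case True
        then show ?thesis using \<pi>.S.syzygies_fg_zero \<pi>.hom_zero a b by simp
      next
        case False
        with reduce[OF a(1) b(1)] obtain r r' s u v p q
          where k: "r \<in> R" "r' \<in> carrier T" "r' \<otimes>\<^bsub>T\<^esub> r = \<one>\<^bsub>T\<^esub>" "s \<in> R"
            and uv: "u \<in> R" "v \<in> R" "p \<in> carrier T" "q \<in> carrier T"
            "p \<otimes>\<^bsub>T\<^esub> u \<oplus>\<^bsub>T\<^esub> q \<otimes>\<^bsub>T\<^esub> v = \<one>\<^bsub>T\<^esub>"
            and eq: "r \<otimes>\<^bsub>T\<^esub> a = s \<otimes>\<^bsub>T\<^esub> u" "r \<otimes>\<^bsub>T\<^esub> b = s \<otimes>\<^bsub>T\<^esub> v"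
          by blast
        have "syzygies_fg RR u v"
          using fc uv by (simp add: finite_conductor_ring_iff)
        then have fg: "syzygies_fg A (\<pi> u) (\<pi> v)"
          by (rule syzygies_fg_quotient[OF uv])
        note carr = \<pi>_hom(1)[OF k(1)] \<pi>_hom(1)[OF k(4)] \<pi>_hom(1)[OF a(1)] \<pi>_hom(1)[OF b(1)]
          \<pi>_hom(1)[OF uv(1)] \<pi>_hom(1)[OF uv(2)]
        obtain e where e: "e \<in> carrier A" "e \<otimes>\<^bsub>A\<^esub> e = e"
          "\<And>z. z \<in> carrier A \<Longrightarrow> e \<otimes>\<^bsub>A\<^esub> z = \<zero>\<^bsub>A\<^esub> \<longleftrightarrow> \<pi> s \<otimes>\<^bsub>A\<^esub> z = \<zero>\<^bsub>A\<^esub>"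
          using prod.annihilator_idempotent[OF carr(2)] by metis
        \<comment> \<open>The inverse r' of r lies in \<open>T\<close> and need not have an image in
          \<open>A\<close>. Cancellation in \<open>A\<close> uses instead that \<open>C\<close> is
          an ideal of \<open>T\<close>: if r z0 is in \<open>C\<close>, then so is z0 = r' (r
          z0).\<close>
        have "\<pi> r \<otimes>\<^bsub>A\<^esub> z = \<zero>\<^bsub>A\<^esub> \<longleftrightarrow> z = \<zero>\<^bsub>A\<^esub>" if z: "z \<in> carrier A" for z
        proof
          assume 0: "\<pi> r \<otimes>\<^bsub>A\<^esub> z = \<zero>\<^bsub>A\<^esub>"
          obtain z0 where z0: "z0 \<in> R" "\<pi> z0 = z" using \<pi>_surj[OF z] .
          have "\<pi> (r \<otimes>\<^bsub>T\<^esub> z0) = \<zero>\<^bsub>A\<^esub>" using 0 z0 k(1) by (simp add: \<pi>_hom)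
          then have "r \<otimes>\<^bsub>T\<^esub> z0 \<in> C" using \<pi>_zero_iff z0 k(1) by simp
          then have "r' \<otimes>\<^bsub>T\<^esub> (r \<otimes>\<^bsub>T\<^esub> z0) \<in> C" using C.I_l_closed k(2) by blast
          then have "z0 \<in> C" using k z0 by (simp add: m_assoc[symmetric])
          then show "z = \<zero>\<^bsub>A\<^esub>" using \<pi>_zero_iff z0 by blast
        qed (use carr in simp)
        then have "syzygies A a' b' = {(x, y) \<in> carrier A \<times> carrier A.
            \<pi> s \<otimes>\<^bsub>A\<^esub> (x \<otimes>\<^bsub>A\<^esub> \<pi> u \<oplus>\<^bsub>A\<^esub> y \<otimes>\<^bsub>A\<^esub> \<pi> v) = \<zero>\<^bsub>A\<^esub>}"
          using \<pi>.S.syzygies_cancel[OF carr] a b k uv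
            arg_cong[OF eq(1), of \<pi>] arg_cong[OF eq(2), of \<pi>] by (simp add: \<pi>_hom)
        also have "\<dots> = {(x, y) \<in> carrier A \<times> carrier A.
            e \<otimes>\<^bsub>A\<^esub> (x \<otimes>\<^bsub>A\<^esub> \<pi> u \<oplus>\<^bsub>A\<^esub> y \<otimes>\<^bsub>A\<^esub> \<pi> v) = \<zero>\<^bsub>A\<^esub>}"
          by (rule Collect_cong, rule prod.case_cong[OF refl])
            (use e(3) carr(5,6) in \<open>simp cong: conj_cong\<close>)
        \<comment> \<open>This is \<open>syzygies_cancel\<close> for the pair (e u, e v), with
          \<one> in place of r and \<open>e\<close> in place of s, read from right to left.\<close>
        also have "\<dots> = syzygies A (e \<otimes>\<^bsub>A\<^esub> \<pi> u) (e \<otimes>\<^bsub>A\<^esub> \<pi> v)"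
          using \<pi>.S.syzygies_cancel[OF \<pi>.S.one_closed e(1), of "e \<otimes>\<^bsub>A\<^esub> \<pi> u" "e \<otimes>\<^bsub>A\<^esub> \<pi> v" "\<pi> u" "\<pi> v"]
            e(1) carr by simp
        finally show ?thesis
          using \<pi>.S.syzygies_fg_idempotent[OF e(1,2) carr(5,6) fg] by (simp add: syzygies_fg_def)
      qed
    qed
    then show ?thesis by (simp add: finite_conductor_ring_iff \<pi>.S.is_cring)
  qed
  have T: "finite_conductor_ring T"
  proof -
    have "syzygies_fg T a b" if ab: "a \<in> carrier T" "b \<in> carrier T" for a b
    proof (cases "a = \<zero>\<^bsub>T\<^esub> \<and> b = \<zero>\<^bsub>T\<^esub>")
      case True
      then show ?thesis using syzygies_fg_zero by simp
    next
      case False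
      \<comment> \<open>Multiplication by c brings the pair into \<open>R\<close>, where the
        condition on ideals applies. As c is a non-zero-divisor, the pair stays non-zero and c can
        be cancelled together with the unit r.\<close>
      have cab: "c \<otimes>\<^bsub>T\<^esub> a \<in> R" "c \<otimes>\<^bsub>T\<^esub> b \<in> R" using C.I_r_closed[OF c(1)] ab by auto
      have "c \<otimes>\<^bsub>T\<^esub> a \<noteq> \<zero>\<^bsub>T\<^esub> \<or> c \<otimes>\<^bsub>T\<^esub> b \<noteq> \<zero>\<^bsub>T\<^esub>" using False c0 ab by blast
      from reduce[OF cab this] obtain r r' s u v p q
        where k: "r \<in> R" "r' \<in> carrier T" "r' \<otimes>\<^bsub>T\<^esub> r = \<one>\<^bsub>T\<^esub>" "s \<in> R"
          and uv: "u \<in> R" "v \<in> R" "p \<in> carrier T" "q \<in> carrier T"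
          "p \<otimes>\<^bsub>T\<^esub> u \<oplus>\<^bsub>T\<^esub> q \<otimes>\<^bsub>T\<^esub> v = \<one>\<^bsub>T\<^esub>"
          and eq: "r \<otimes>\<^bsub>T\<^esub> (c \<otimes>\<^bsub>T\<^esub> a) = s \<otimes>\<^bsub>T\<^esub> u" "r \<otimes>\<^bsub>T\<^esub> (c \<otimes>\<^bsub>T\<^esub> b) = s \<otimes>\<^bsub>T\<^esub> v"
          and s: "non_zero_divisor s T"
        by blast
      have carr: "r \<otimes>\<^bsub>T\<^esub> c \<in> carrier T" "s \<in> carrier T" "u \<in> carrier T" "v \<in> carrier T"
        using k uv cT by auto
      have rc: "r \<otimes>\<^bsub>T\<^esub> c \<otimes>\<^bsub>T\<^esub> z = \<zero>\<^bsub>T\<^esub> \<longleftrightarrow> z = \<zero>\<^bsub>T\<^esub>" if z: "z \<in> carrier T" for z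
        using unit_cancel[of r' r "c \<otimes>\<^bsub>T\<^esub> z"] c0[OF z] z cT k carr by (auto simp: m_assoc)
      have "syzygies T a b = {(x, y) \<in> carrier T \<times> carrier T.
          s \<otimes>\<^bsub>T\<^esub> (x \<otimes>\<^bsub>T\<^esub> u \<oplus>\<^bsub>T\<^esub> y \<otimes>\<^bsub>T\<^esub> v) = \<zero>\<^bsub>T\<^esub>}"
        by (rule syzygies_cancel[OF carr(1,2) ab carr(3,4) _ _ rc]) (use eq k ab cT in \<open>simp_all add: m_assoc\<close>)
      also have "\<dots> = syzygies T u v"
        using s carr by (auto simp: syzygies_def non_zero_divisor_def)
      finally show ?thesis
        using syzygies_fg_unimodular[OF carr(3,4) uv(3-5)] by (simp add: syzygies_fg_def)
    qed
    then show ?thesis by (simp add: finite_conductor_ring_iff is_cring)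
  qed
  show ?thesis
    using A_R R_A T prod.finite_conductor_ring_factor by blast
qed

end
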